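(* Let $\mathbb{F}$ be an infinite field with $\operatorname{char}\mathbb{F}\neq 2$, let $n=3$ and $d\geq 1$. Let $D_{\max}=D_{\max}(3,d)$ be the highest degree of an indecomposable element of the algebra $R^{O(3)}$ of matrix $O(3)$-invariants of $d$ matrices (equivalently, the maximal degree of the elements of a minimal homogeneous system of generators of $R^{O(3)}$). Then: \begin{itemize} \item if $\operatorname{char}\mathbb{F}=3$, then $2d+4\leq D_{\max}\leq 2d+7$; \item if $\operatorname{char}\mathbb{F}\neq 2,3$, then $D_{\max}=6$. \end{itemize}
   Context: Let $R=\mathbb{F}[x_{ij}(k)\mid 1\leq i,j\leq 3,\ 1\leq k\leq d]$ be the commutative polynomial algebra, graded by total degree, and let $X_k=(x_{ij}(k))_{1\le i,j\le 3}$ be the generic $3\times 3$ matrices, $1\leq k\leq d$. The algebra of matrix $O(3)$-invariants $R^{O(3)}$ is the subalgebra of $R$ generated by all $\sigma_t(A)$, where $1\leq t\leq 3$ and $A$ ranges over all monomials in $X_1,\ldots,X_d,X_1^T,\ldots,X_d^T$; here $\sigma_t(A)$ is the $t$-th coefficient of the characteristic polynomial of $A$, i.e. $\det(\lambda E-A)=\lambda^3-\sigma_1(A)\lambda^2+\sigma_2(A)\lambda-\sigma_3(A)$. It is a graded subalgebra of $R$. For an $\mathbb{N}$-graded algebra $\mathcal{A}$, let $\mathcal{A}^+$ be the subalgebra generated by homogeneous elements of positive degree. An element of $\mathcal{A}$ is decomposable if it lies in $(\mathcal{A}^+)^2$, i.e. it is a polynomial in elements of strictly lower degree; otherwise it is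 indecomposable. A minimal homogeneous system of generators is a generating set consisting of homogeneous elements which is minimal by inclusion. *)

theory Defs
  imports
    "HOL-Analysis.Analysis"
    "HOL-Computational_Algebra.Computational_Algebra"
    "HOL-Library.Poly_Mapping"
begin

text \<open>
  Multivariate polynomials are finitely supported functions from monomials (finitely supported
  exponent vectors) to coefficients; \<open>*\<close> on this type is the convolution product.
  The algebra \<open>R\<close> has the variables \<open>x\<^sub>i\<^sub>j(k)\<close>, indexed by \<open>(i, j, k)\<close>; the index \<open>k\<close>
  ranges over a finite (hence nonempty) type \<open>'d\<close>, so that \<open>d = CARD('d) \<ge> 1\<close>.
\<close>

type_synonym ('v, 'a) mvpoly = "('v \<Rightarrow>\<^sub>0 nat) \<Rightarrow>\<^sub>0 'a"

type_synonym ('a, 'd) matrix_poly = "(3 \<times> 3 \<times> 'd, 'a) mvpoly"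

definition pvar :: "'v \<Rightarrow> ('v, 'a::comm_ring_1) mvpoly" where
  "pvar v = Poly_Mapping.single (Poly_Mapping.single v 1) 1"

definition pscale :: "'a::comm_ring_1 \<Rightarrow> ('v, 'a) mvpoly \<Rightarrow> ('v, 'a) mvpoly" where
  "pscale c p = Poly_Mapping.single 0 c * p"

interpretation mvp: vector_space "pscale :: 'a::field \<Rightarrow> ('v, 'a) mvpoly \<Rightarrow> ('v, 'a) mvpoly"
proof
  fix a b :: 'a and p q :: "('v, 'a) mvpoly"
  show "pscale a (p + q) = pscale a p + pscale a q"
    by (simp add: pscale_def distrib_left)
  show "pscale (a + b) p = pscale a p + pscale b p"
    by (simp add: pscale_def single_add distrib_right)
  show "pscale a (pscale b p) = pscale (a * b) p"
    by (simp add: pscale_def mult.assoc [symmetric] mult_single)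
  show "pscale 1 p = p"
    by (simp add: pscale_def)
qed


subsection \<open>Grading by total degree\<close>

definition monomial_degree :: "('v \<Rightarrow>\<^sub>0 nat) \<Rightarrow> nat" where
  "monomial_degree m = (\<Sum>v\<in>Poly_Mapping.keys m. Poly_Mapping.lookup m v)"

text \<open>The zero polynomial gets degree \<open>0\<close>.\<close>

definition total_degree :: "('v, 'a::zero) mvpoly \<Rightarrow> nat" where
  "total_degree p = Max (insert 0 (monomial_degree ` Poly_Mapping.keys p))"

definition homogeneous :: "('v, 'a::zero) mvpoly \<Rightarrow> bool" where
  "homogeneous p \<longleftrightarrow> (\<forall>m\<in>Poly_Mapping.keys p. monomial_degree m = total_degree p)"


subsection \<open>Subalgebras, decomposable elements, minimal generating systems\<close>

definition nonunital_subalgebra :: "('v, 'a::field) mvpoly set \<Rightarrow> bool" where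
  "nonunital_subalgebra S \<longleftrightarrow> mvp.subspace S \<and> (\<forall>f\<in>S. \<forall>g\<in>S. f * g \<in> S)"

definition subalgebra :: "('v, 'a::field) mvpoly set \<Rightarrow> bool" where
  "subalgebra S \<longleftrightarrow> nonunital_subalgebra S \<and> 1 \<in> S"

definition generated_subalgebra :: "('v, 'a::field) mvpoly set \<Rightarrow> ('v, 'a) mvpoly set" where
  "generated_subalgebra G = subalgebra hull G"

text \<open>\<open>\<A>\<^sup>+\<close> does not contain \<open>1\<close>, so it is generated as a non-unital algebra.\<close>

definition positive_part :: "('v, 'a::field) mvpoly set \<Rightarrow> ('v, 'a) mvpoly set" where
  "positive_part \<A> = nonunital_subalgebra hull {f \<in> \<A>. homogeneous f \<and> total_degree f > 0}"

text \<open>\<open>(\<A>\<^sup>+)\<^sup>2\<close>\<close>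

definition decomposables :: "('v, 'a::field) mvpoly set \<Rightarrow> ('v, 'a) mvpoly set" where
  "decomposables \<A> = mvp.span {f * g | f g. f \<in> positive_part \<A> \<and> g \<in> positive_part \<A>}"

text \<open>
  Only homogeneous indecomposable elements are considered for \<open>D\<^sub>m\<^sub>a\<^sub>x\<close>: adding a decomposable
  element of large degree to an indecomposable one gives inhomogeneous indecomposable elements
  of arbitrarily large total degree.
\<close>

definition is_D_max :: "('v, 'a::field) mvpoly set \<Rightarrow> nat \<Rightarrow> bool" where
  "is_D_max \<A> D \<longleftrightarrow>
     (\<exists>f\<in>\<A>. homogeneous f \<and> f \<notin> decomposables \<A> \<and> total_degree f = D) \<and>
     (\<forall>f\<in>\<A>. homogeneous f \<and> f \<notin> decomposables \<A> \<longrightarrow> total_degree f \<le> D)"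

definition minimal_homogeneous_generators ::
    "('v, 'a::field) mvpoly set \<Rightarrow> ('v, 'a) mvpoly set \<Rightarrow> bool" where
  "minimal_homogeneous_generators \<A> G \<longleftrightarrow>
     (\<forall>g\<in>G. homogeneous g) \<and> generated_subalgebra G = \<A> \<and>
     (\<forall>H. H \<subset> G \<longrightarrow> generated_subalgebra H \<noteq> \<A>)"


subsection \<open>Matrix \<open>O(3)\<close>-invariants\<close>

definition char_polynomial :: "'r::comm_ring_1^'n^'n \<Rightarrow> 'r poly" where
  "char_polynomial A = det (mat [:0, 1:] - map_matrix (\<lambda>c. [:c:]) A)"

text \<open>\<open>det (\<lambda>E - A) = \<lambda>\<^sup>n - \<sigma>\<^sub>1(A) \<lambda>\<^sup>n\<^sup>-\<^sup>1 + \<sigma>\<^sub>2(A) \<lambda>\<^sup>n\<^sup>-\<^sup>2 - \<dots>\<close>; to be used for \<open>t \<le> n\<close> only.\<close>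

definition sigma :: "nat \<Rightarrow> 'r::comm_ring_1^'n^'n \<Rightarrow> 'r" where
  "sigma t A = (-1) ^ t * coeff (char_polynomial A) (CARD('n) - t)"

definition generic_matrix :: "'d \<Rightarrow> ('a::comm_ring_1, 'd) matrix_poly^3^3" where
  "generic_matrix k = (\<chi> i j. pvar (i, j, k))"

text \<open>The nonempty words in the generic matrices and their transposes.\<close>

inductive_set matrix_monomials :: "(('a::comm_ring_1, 'd) matrix_poly^3^3) set" where
  generic: "generic_matrix k \<in> matrix_monomials"
| transposed: "transpose (generic_matrix k) \<in> matrix_monomials"
| product: "A \<in> matrix_monomials \<Longrightarrow> B \<in> matrix_monomials \<Longrightarrow> A ** B \<in> matrix_monomials"

definition O3_invariants :: "('a::field, 'd::finite) matrix_poly set" where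
  "O3_invariants = generated_subalgebra {sigma t A | t A. t \<in> {1..3} \<and> A \<in> matrix_monomials}"

end

theory Submission
  imports Defs
begin

text \<open>
  The algebra is generated by the homogeneous elements \<open>\<sigma>\<^sub>t(w)\<close>, where
  \<open>w\<close> is a word in the generic matrices and their transposes. By a graded version of
  Nakayama's lemma (\<open>maximal_degree_exists\<close>) the number
  \<open>D\<^sub>m\<^sub>a\<^sub>x\<close> exists, and it is attained by every minimal homogeneous
  system of generators, as soon as the generators of large degree are decomposable and some
  indecomposable element is known. Since \<open>2 \<sigma>\<^sub>2(w) = tr(w)\<^sup>2 -
  tr(w\<^sup>2)\<close> and \<open>\<sigma>\<^sub>3\<close> is multiplicative, the upper bounds only
  require that traces of long words are decomposable.

  \<^emph>\<open>Upper bound for characteristic different from 2 and 3.\<close> By the theorem of Cayley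
  and Hamilton, \<open>tr(x\<^sup>3 c)\<close> is decomposable. Higman's computation turns this into the
  decomposability of \<open>tr(x\<^sup>2 z y\<^sup>2 c)\<close>, from which it follows that the trace of
  seven factors is alternating. Symmetrising \<open>x\<^sup>3 = 0\<close> over three blocks of two
  factors then shows that six times such a trace is decomposable (\<open>tr_seven\<close>). So traces of
  degree at least 7 are decomposable.

  \<^emph>\<open>Upper bound for characteristic 3.\<close> Each letter is split into its symmetric and
  its skew-symmetric part. A skew-symmetric matrix is the cross product with an axis, and a product of
  two of them has rank one up to a scalar. Therefore a trace with four skew-symmetric factors is
  decomposable (\<open>tr_four_skews_D\<close>). As a commutator of symmetric matrices is
  skew-symmetric, symmetric letters can be sorted at the expense of new skew-symmetric factors. With
  three such factors a trace becomes a determinant of three vectors \<open>A u\<close>, \<open>B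
  v\<close>, \<open>C w\<close>, where \<open>A\<close>, \<open>B\<close>, \<open>C\<close> are words in
  the symmetric letters. Modulo decomposable elements the letters act on the three slots as commuting
  variables in which the symmetric functions of positive degree vanish
  (\<open>triple_sym_words_D\<close>). The ring of coinvariants of the symmetric group on three points,
  acting on \<open>d\<close> copies of its permutation representation, vanishes in degree \<open>2d +
  2\<close> in characteristic three (\<open>three_slots_vanish\<close> uses just the relations that are
  needed). Each of the three axes has degree at most two, being the axis of a letter or of a commutator;
  this gives the bound \<open>(2d + 1) + 6\<close>. Fewer skew-symmetric factors lead to the same
  situation or to smaller degrees.

  \<^emph>\<open>Lower bound.\<close> One matrix is replaced by \<open>b N + t K\<close>, where
  \<open>N\<close> is the diagonal matrix \<open>diag(0, 1, -1)\<close> and \<open>K\<close> is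
  skew-symmetric with axis \<open>(1, 1, 1)\<close>, and the others by scalar matrices
  \<open>a\<^sub>k\<close>. The coefficient at \<open>b\<^sup>3 t\<^sup>3\<close> of a product of two
  invariants of positive degree turns out to be a combination of constant coefficients of these
  invariants (\<open>bicoeff_33_mult\<close>). In characteristic three, constant coefficients are
  generated by the cubes of monomials in the \<open>a\<^sub>k\<close>, so the monomial \<open>\<Prod>
  a\<^sub>k\<^sup>2\<close> cannot occur. But it occurs for the trace of a word with six letters from
  the first matrix and two from each other one (\<open>indecomposable_trace\<close>), which has degree
  \<open>6 + 2 (d - 1)\<close>. In the other characteristics the same word without the other matrices is
  indecomposable of degree 6.
\<close>

section \<open>Three by three matrices\<close>

text \<open>
  Matrices over a commutative ring with nine explicit entries. They form an instance of
  \<^class>\<open>ring_1\<close>, so that words are list products and identities between words hold by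
  ring normalisation; identities that involve the entries reduce to polynomial identities.
\<close>

datatype 'r mat3 = Mat3 'r 'r 'r 'r 'r 'r 'r 'r 'r

instantiation mat3 :: (comm_ring_1) ring_1
begin

definition zero_mat3 where "0 = Mat3 0 0 0 0 0 0 0 0 0"

definition one_mat3 where "1 = Mat3 1 0 0 0 1 0 0 0 1"

fun plus_mat3 where
  "Mat3 a b c d e f g h i + Mat3 a' b' c' d' e' f' g' h' i' =
     Mat3 (a + a') (b + b') (c + c') (d + d') (e + e') (f + f') (g + g') (h + h') (i + i')"

fun uminus_mat3 where
  "- Mat3 a b c d e f g h i = Mat3 (- a) (- b) (- c) (- d) (- e) (- f) (- g) (- h) (- i)"

fun minus_mat3 where
  "Mat3 a b c d e f g h i - Mat3 a' b' c' d' e' f' g' h' i' =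
     Mat3 (a - a') (b - b') (c - c') (d - d') (e - e') (f - f') (g - g') (h - h') (i - i')"

fun times_mat3 where
  "Mat3 a b c d e f g h i * Mat3 a' b' c' d' e' f' g' h' i' =
     Mat3 (a*a' + b*d' + c*g') (a*b' + b*e' + c*h') (a*c' + b*f' + c*i')
          (d*a' + e*d' + f*g') (d*b' + e*e' + f*h') (d*c' + e*f' + f*i')
          (g*a' + h*d' + i*g') (g*b' + h*e' + i*h') (g*c' + h*f' + i*i')"

instance
proof
  fix a b c :: "'a mat3"
  show "a * b * c = a * (b * c)"
    by (cases a; cases b; cases c) (simp add: algebra_simps)
  show "(a + b) * c = a * c + b * c" "a * (b + c) = a * b + a * c"
    by (cases a; cases b; cases c; simp add: algebra_simps)+
  show "a + b + c = a + (b + c)" "a + b = b + a" "0 + a = a" "- a + a = 0" "a - b = a + - b"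
      "1 * a = a" "a * 1 = a"
    by (cases a; cases b; cases c; simp add: zero_mat3_def one_mat3_def)+
  show "(0 :: 'a mat3) \<noteq> 1"
    by (simp add: zero_mat3_def one_mat3_def)
qed

end

datatype 'r vec3 = Vec3 'r 'r 'r

instantiation vec3 :: (comm_ring_1) ab_group_add
begin
definition zero_vec3 where "0 = Vec3 0 0 0"
fun plus_vec3 where "Vec3 a b c + Vec3 a' b' c' = Vec3 (a + a') (b + b') (c + c')"
fun uminus_vec3 where "- Vec3 a b c = Vec3 (- a) (- b) (- c)"
fun minus_vec3 where "Vec3 a b c - Vec3 a' b' c' = Vec3 (a - a') (b - b') (c - c')"
instance
proof
  fix a b c :: "'a vec3"
  show "a + b + c = a + (b + c)" "a + b = b + a" "0 + a = a" "- a + a = 0" "a - b = a + - b"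
    by (cases a; cases b; cases c; simp add: zero_vec3_def)+
qed
end

fun smul :: "'r::comm_ring_1 \<Rightarrow> 'r mat3 \<Rightarrow> 'r mat3" where
  "smul r (Mat3 a b c d e f g h i) =
     Mat3 (r*a) (r*b) (r*c) (r*d) (r*e) (r*f) (r*g) (r*h) (r*i)"

fun tr3 :: "'r::comm_ring_1 mat3 \<Rightarrow> 'r" where
  "tr3 (Mat3 a b c d e f g h i) = a + e + i"

text \<open>
  The sum of the principal two by two minors, that is the second coefficient
  \<open>\<sigma>\<^sub>2\<close>.
\<close>

fun minors3 :: "'r::comm_ring_1 mat3 \<Rightarrow> 'r" where
  "minors3 (Mat3 a b c d e f g h i) = (a*e - b*d) + (a*i - c*g) + (e*i - f*h)"

fun det3 :: "'r::comm_ring_1 mat3 \<Rightarrow> 'r" where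
  "det3 (Mat3 a b c d e f g h i) = a*(e*i - f*h) - b*(d*i - f*g) + c*(d*h - e*g)"

fun transp3 :: "'r::comm_ring_1 mat3 \<Rightarrow> 'r mat3" where
  "transp3 (Mat3 a b c d e f g h i) = Mat3 a d g b e h c f i"

text \<open>
  The skew-symmetric matrix of the linear map \<open>w \<mapsto> v \<times> w\<close>.
\<close>

fun hat :: "'r::comm_ring_1 vec3 \<Rightarrow> 'r mat3" where
  "hat (Vec3 x y z) = Mat3 0 (-z) y z 0 (-x) (-y) x 0"

fun app3 :: "'r::comm_ring_1 mat3 \<Rightarrow> 'r vec3 \<Rightarrow> 'r vec3" where
  "app3 (Mat3 a b c d e f g h i) (Vec3 x y z) = Vec3 (a*x + b*y + c*z) (d*x + e*y + f*z) (g*x + h*y + i*z)"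

fun dot3 :: "'r::comm_ring_1 vec3 \<Rightarrow> 'r vec3 \<Rightarrow> 'r" where
  "dot3 (Vec3 x y z) (Vec3 x' y' z') = x*x' + y*y' + z*z'"

fun vcross :: "'r::comm_ring_1 vec3 \<Rightarrow> 'r vec3 \<Rightarrow> 'r vec3" where
  "vcross (Vec3 x y z) (Vec3 x' y' z') = Vec3 (y*z' - z*y') (z*x' - x*z') (x*y' - y*x')"

definition triple :: "'r::comm_ring_1 vec3 \<Rightarrow> 'r vec3 \<Rightarrow> 'r vec3 \<Rightarrow> 'r" where
  "triple u v w = dot3 u (vcross v w)"

fun outer :: "'r::comm_ring_1 vec3 \<Rightarrow> 'r vec3 \<Rightarrow> 'r mat3" where
  "outer (Vec3 x y z) (Vec3 x' y' z') = Mat3 (x*x') (x*y') (x*z') (y*x') (y*y') (y*z') (z*x') (z*y') (z*z')"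

lemma smul_simps:
  "smul r (A + B) = smul r A + smul r B" "smul r (A - B) = smul r A - smul r B" "smul r (- A) = - smul r A"
  "smul r A * B = smul r (A * B)" "A * smul r B = smul r (A * B)" "smul r (smul s A) = smul (r * s) A"
  "smul r 0 = 0" "smul 1 A = A"
  by (cases A; cases B; simp add: algebra_simps zero_mat3_def)+

lemma tr3_simps [simp]:
  "tr3 (A + B) = tr3 A + tr3 B" "tr3 (A - B) = tr3 A - tr3 B" "tr3 (- A) = - tr3 A" "tr3 0 = 0" "tr3 1 = 3"
  "tr3 (smul r A) = r * tr3 A" "tr3 (transp3 A) = tr3 A"
  by (cases A; cases B; simp add: algebra_simps zero_mat3_def one_mat3_def)+

lemma tr3_mult_commute: "tr3 (A * B) = tr3 (B * A)"
  by (cases A; cases B) (simp add: algebra_simps)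

lemma transp3_simps [simp]:
  "transp3 (A + B) = transp3 A + transp3 B" "transp3 (A - B) = transp3 A - transp3 B" "transp3 (- A) = - transp3 A"
  "transp3 (A * B) = transp3 B * transp3 A" "transp3 (transp3 A) = A" "transp3 0 = 0" "transp3 1 = 1"
  "transp3 (smul r A) = smul r (transp3 A)"
  by (cases A; cases B; simp add: algebra_simps zero_mat3_def one_mat3_def)+

lemma det3_mult: "det3 (A * B) = det3 A * det3 B"
  by (cases A; cases B; simp add: algebra_simps power2_eq_square power3_eq_cube)

lemma det3_smul: "det3 (smul r A) = r ^ 3 * det3 A"
  by (cases A; simp add: algebra_simps power2_eq_square power3_eq_cube)

lemma det3_one: "det3 1 = 1" by (simp add: one_mat3_def)
lemma det3_transp: "det3 (transp3 A) = det3 A" by (cases A; simp add: algebra_simps power2_eq_square power3_eq_cube)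

lemma minors3_smul: "minors3 (smul r A) = r ^ 2 * minors3 A"
  by (cases A; simp add: algebra_simps power2_eq_square power3_eq_cube)

lemma twice_minors3: "2 * minors3 A = tr3 A * tr3 A - tr3 (A * A)"
  by (cases A; simp add: algebra_simps power2_eq_square power3_eq_cube)

lemma cayley_hamilton3: "A * A * A = smul (tr3 A) (A * A) - smul (minors3 A) A + smul (det3 A) 1"
  by (cases A; simp add: one_mat3_def algebra_simps)

text \<open>
  The two brackets are \<open>tr (adj A B)\<close> and \<open>tr (adj B A)\<close>, with the adjugate
  written as \<open>A\<^sup>2 - tr(A) A + \<sigma>\<^sub>2(A)\<close>. Hence the determinant of a sum of
  words is a polynomial in traces and in determinants of words, also when \<open>3\<close> is not
  invertible.
\<close>

lemma det3_add:
  "det3 (A + B) = det3 A + det3 B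
    + (tr3 (A * A * B) - tr3 A * tr3 (A * B) + minors3 A * tr3 B)
    + (tr3 (B * B * A) - tr3 B * tr3 (B * A) + minors3 B * tr3 A)"
  by (cases A; cases B; simp add: algebra_simps power2_eq_square power3_eq_cube)

text \<open>
  Apart from a scalar, a product of two skew-symmetric matrices has rank one. This is what makes words
  with many skew-symmetric factors decomposable.
\<close>

lemma hat_hat: "hat u * hat v = outer v u - smul (dot3 u v) 1"
  by (cases u; cases v) (simp add: one_mat3_def algebra_simps)

text \<open>
  The derivative at the identity of \<open>M\<^sup>T [M p] M = det M [p]\<close>, where
  \<open>[p]\<close> is the matrix of the cross product with \<open>p\<close>. It moves any matrix past
  a skew-symmetric one.
\<close>

lemma hat_mult: "hat p * A = smul (tr3 A) (hat p) - hat (app3 A p) - transp3 A * hat p"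
  by (cases p; cases A) (simp add: algebra_simps)

lemma tr3_outer: "tr3 (outer x y * M) = dot3 y (app3 M x)"
  by (cases x; cases y; cases M) (simp add: algebra_simps)

lemma dot3_app3: "dot3 x (app3 M y) = dot3 (app3 (transp3 M) x) y"
  by (cases x; cases y; cases M) (simp add: algebra_simps)

lemma app3_mult: "app3 (A * B) v = app3 A (app3 B v)"
  by (cases v; cases A; cases B) (simp add: algebra_simps)

lemma app3_hat: "app3 (hat p) v = vcross p v"
  by (cases p; cases v) (simp add: algebra_simps)

lemma triple_derivation:
  "triple (app3 A u) v w + triple u (app3 A v) w + triple u v (app3 A w) = tr3 A * triple u v w"
  unfolding triple_def by (cases u; cases v; cases w; cases A; simp add: algebra_simps power2_eq_square power3_eq_cube)

lemma triple_vcross: "triple (vcross p y) v w = dot3 p v * dot3 y w - dot3 p w * dot3 y v"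
  unfolding triple_def by (cases p; cases y; cases w; cases v; simp add: algebra_simps power2_eq_square power3_eq_cube)

section \<open>Homogeneous components\<close>

text \<open>
  Zero is homogeneous of every degree here, in contrast to \<^const>\<open>homogeneous\<close> together
  with \<^const>\<open>total_degree\<close>; this makes the predicate closed under sums and products.
\<close>

definition hom_degree :: "nat \<Rightarrow> ('v, 'a::zero) mvpoly \<Rightarrow> bool" where
  "hom_degree n p \<longleftrightarrow> (\<forall>m\<in>Poly_Mapping.keys p. monomial_degree m = n)"

lift_definition component :: "nat \<Rightarrow> ('v, 'a::zero) mvpoly \<Rightarrow> ('v, 'a) mvpoly" is
  "\<lambda>n p m. if monomial_degree m = n then p m else 0"
  by (rule finite_subset) auto

lemma monomial_degree_add: "monomial_degree (m + m') = monomial_degree m + monomial_degree m'"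
  unfolding monomial_degree_def by (rule setsum_keys_plus_distrib) auto

lemma monomial_degree_zero [simp]: "monomial_degree 0 = 0"
  by (simp add: monomial_degree_def)

lemma hom_degree_zero [simp]: "hom_degree n 0"
  by (simp add: hom_degree_def)

lemma hom_degree_one: "hom_degree 0 (1 :: ('v, 'a::zero_neq_one) mvpoly)"
  by (simp add: hom_degree_def)

lemma hom_degree_add: "hom_degree n p \<Longrightarrow> hom_degree n q \<Longrightarrow> hom_degree n (p + q)"
  unfolding hom_degree_def using keys_add[of p q] by blast

lemma hom_degree_uminus: "hom_degree n (p :: ('v, 'a::ab_group_add) mvpoly) \<Longrightarrow> hom_degree n (- p)"
  unfolding hom_degree_def by (auto simp: in_keys_iff)

lemma hom_degree_diff:
  "hom_degree n (p :: ('v, 'a::ab_group_add) mvpoly) \<Longrightarrow> hom_degree n q \<Longrightarrow> hom_degree n (p - q)"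
  using hom_degree_add[of n p "- q"] hom_degree_uminus[of n q] by simp

lemma hom_degree_mult:
  "hom_degree n p \<Longrightarrow> hom_degree k q \<Longrightarrow> hom_degree (n + k) (p * q :: ('v, 'a::semiring_0) mvpoly)"
  unfolding hom_degree_def using keys_mult[of p q] by (fastforce simp: monomial_degree_add)

lemma hom_degree_homogeneous:
  assumes "hom_degree n p" shows "homogeneous p" "p \<noteq> 0 \<Longrightarrow> total_degree p = n"
proof -
  have *: "total_degree p = n" if "p \<noteq> 0"
  proof -
    have "Poly_Mapping.keys p \<noteq> {}" using that by simp
    moreover from this assms have "monomial_degree ` Poly_Mapping.keys p = {n}"
      by (auto simp: hom_degree_def simp del: keys_eq_empty)
    ultimately show ?thesis by (simp add: total_degree_def)
  qed
  then show "p \<noteq> 0 \<Longrightarrow> total_degree p = n" .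
  show "homogeneous p"
    using * assms by (cases "p = 0") (auto simp: homogeneous_def hom_degree_def)
qed

lemma homogeneous_hom_degree: "homogeneous p \<Longrightarrow> hom_degree (total_degree p) p"
  by (simp add: homogeneous_def hom_degree_def)

lemma lookup_component:
  "Poly_Mapping.lookup (component n p) m = (if monomial_degree m = n then Poly_Mapping.lookup p m else 0)"
  by transfer simp

lemma hom_degree_component: "hom_degree n (component n p)"
  by (auto simp: hom_degree_def in_keys_iff lookup_component split: if_splits)

lemma component_add: "component n (p + q) = component n p + component n (q :: ('v, 'a::monoid_add) mvpoly)"
  by (rule poly_mapping_eqI) (simp add: lookup_component lookup_add)

lemma component_zero [simp]: "component n 0 = 0"
  by (rule poly_mapping_eqI) (simp add: lookup_component)

lemma component_sum: "component n (sum f I) = (\<Sum>i\<in>I. component n (f i :: ('v, 'a::comm_monoid_add) mvpoly))"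
  by (induction I rule: infinite_finite_induct) (simp_all add: component_add)

lemma component_hom: "hom_degree k p \<Longrightarrow> component n p = (if n = k then p else 0)"
  by (rule poly_mapping_eqI) (auto simp: hom_degree_def lookup_component in_keys_iff)

lemma sum_components:
  assumes "total_degree p \<le> N"
  shows "p = (\<Sum>k\<le>N. component k (p :: ('v, 'a::comm_monoid_add) mvpoly))"
proof (rule poly_mapping_eqI)
  fix m
  have "monomial_degree m \<le> N" if "Poly_Mapping.lookup p m \<noteq> 0"
  proof -
    have "monomial_degree m \<le> total_degree p"
      unfolding total_degree_def using that by (intro Max_ge) (auto simp: in_keys_iff)
    then show ?thesis using assms by simp
  qed
  then show "Poly_Mapping.lookup p m = Poly_Mapping.lookup (\<Sum>k\<le>N. component k p) m"
    by (cases "Poly_Mapping.lookup p m = 0") (simp_all add: lookup_sum lookup_component sum.delta')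
qed

lemma component_mult:
  "component n (p * q) = (\<Sum>i\<le>n. component i p * component (n - i) (q :: ('v, 'a::semiring_0) mvpoly))"
proof -
  define N where "N = max n (max (total_degree p) (total_degree q))"
  have "component n (p * q) = component n ((\<Sum>i\<le>N. component i p) * (\<Sum>j\<le>N. component j q))"
    using sum_components[of p N] sum_components[of q N] by (simp add: N_def)
  also have "\<dots> = (\<Sum>i\<le>N. \<Sum>j\<le>N. component n (component i p * component j q))"
    by (simp add: sum_product component_sum)
  also have "\<dots> = (\<Sum>i\<le>N. \<Sum>j\<le>N. if j = n - i \<and> i \<le> n then component i p * component j q else 0)"
    by (intro sum.cong refl) (auto simp: component_hom[OF hom_degree_mult[OF hom_degree_component hom_degree_component]])
  also have "\<dots> = (\<Sum>i\<le>N. if i \<le> n then component i p * component (n - i) q else 0)"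
  proof (intro sum.cong refl)
    fix i
    have "n - i \<le> N" by (simp add: N_def)
    then show "(\<Sum>j\<le>N. if j = n - i \<and> i \<le> n then component i p * component j q else 0)
      = (if i \<le> n then component i p * component (n - i) q else 0)"
      by (auto simp: sum.delta)
  qed
  also have "\<dots> = (\<Sum>i\<le>n. component i p * component (n - i) q)"
    by (intro sum.mono_neutral_cong_right) (auto simp: N_def)
  finally show ?thesis .
qed

abbreviation cst :: "'a \<Rightarrow> ('v, 'a::zero) mvpoly" where "cst c \<equiv> Poly_Mapping.single 0 c"

lemma hom_degree_cst: "hom_degree 0 (cst c)"
  by (auto simp: hom_degree_def)

lemma hom_degree_zero_cst:
  assumes "hom_degree 0 p" shows "p = cst (Poly_Mapping.lookup p 0)"
proof (rule poly_mapping_eqI)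
  fix m
  have "m = 0" if "Poly_Mapping.lookup p m \<noteq> 0"
  proof (rule poly_mapping_eqI)
    fix v
    have "monomial_degree m = 0" using assms that by (auto simp: hom_degree_def in_keys_iff)
    then show "Poly_Mapping.lookup m v = Poly_Mapping.lookup 0 v"
      by (cases "v \<in> Poly_Mapping.keys m") (auto simp: monomial_degree_def in_keys_iff)
  qed
  then show "Poly_Mapping.lookup p m = Poly_Mapping.lookup (cst (Poly_Mapping.lookup p 0)) m"
    by (cases "m = 0") (auto simp: lookup_single)
qed

lemma component_pscale: "component n (pscale c p) = pscale c (component n p)"
proof -
  have "component n (pscale c p) = (\<Sum>i\<le>n. component i (cst c) * component (n - i) p)"
    unfolding pscale_def by (rule component_mult)
  also have "\<dots> = (\<Sum>i\<le>n. if i = 0 then cst c * component n p else 0)"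
    by (intro sum.cong refl) (simp add: component_hom[OF hom_degree_cst])
  finally show ?thesis by (simp add: pscale_def)
qed

section \<open>Graded algebras and their generators\<close>

lemma nonunital_subalgebra_Inter: "Ball T nonunital_subalgebra \<Longrightarrow> nonunital_subalgebra (\<Inter>T)"
  by (auto simp: nonunital_subalgebra_def mvp.subspace_def)

lemma subalgebra_Inter: "Ball T subalgebra \<Longrightarrow> subalgebra (\<Inter>T)"
  by (auto simp: subalgebra_def nonunital_subalgebra_def mvp.subspace_def)

lemma subalgebra_generated: "subalgebra (generated_subalgebra G)"
  unfolding generated_subalgebra_def by (rule hull_in[of subalgebra]) (rule subalgebra_Inter)

lemma generated_subalgebra_incl: "G \<subseteq> generated_subalgebra G"
  unfolding generated_subalgebra_def by (rule hull_subset)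

lemma generated_subalgebra_minimal: "G \<subseteq> S \<Longrightarrow> subalgebra S \<Longrightarrow> generated_subalgebra G \<subseteq> S"
  unfolding generated_subalgebra_def by (rule hull_minimal)

lemma nonunital_positive_part: "nonunital_subalgebra (positive_part A)"
  unfolding positive_part_def by (rule hull_in[of nonunital_subalgebra]) (rule nonunital_subalgebra_Inter)

lemma positive_part_incl: "f \<in> A \<Longrightarrow> homogeneous f \<Longrightarrow> total_degree f > 0 \<Longrightarrow> f \<in> positive_part A"
  unfolding positive_part_def by (rule hull_inc) simp

lemma nonunital_subalgebraD:
  assumes "nonunital_subalgebra S"
  shows "0 \<in> S" "f \<in> S \<Longrightarrow> g \<in> S \<Longrightarrow> f + g \<in> S" "f \<in> S \<Longrightarrow> pscale c f \<in> S" "f \<in> S \<Longrightarrow> g \<in> S \<Longrightarrow> f * g \<in> S"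
    "(\<And>i. i \<in> I \<Longrightarrow> h i \<in> S) \<Longrightarrow> sum h I \<in> S"
  using assms mvp.subspace_sum[of S I h] by (auto simp: nonunital_subalgebra_def mvp.subspace_def)

lemma subalgebraD:
  assumes "subalgebra S"
  shows "1 \<in> S" "nonunital_subalgebra S"
  using assms by (auto simp: subalgebra_def)

lemma subalgebra_cst: "subalgebra S \<Longrightarrow> cst c \<in> S"
  using nonunital_subalgebraD(3)[OF subalgebraD(2), of S 1 c] subalgebraD(1)[of S] by (simp add: pscale_def)

lemma nonunital_subalgebra_components:
  assumes "nonunital_subalgebra S" "\<And>k. component k f \<in> S" shows "f \<in> S"
proof -
  have "(\<Sum>k\<le>total_degree f. component k f) \<in> S"
    using assms by (intro nonunital_subalgebraD(5))
  then show ?thesis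
    by (simp only: sum_components[OF order_refl, symmetric])
qed

text \<open>
  A set of homogeneous generators; constants are admitted, because a minimal generating system is only
  known to be homogeneous.
\<close>

locale graded_generators =
  fixes G :: "('v, 'a::field) mvpoly set" and A
  assumes homG: "\<And>g. g \<in> G \<Longrightarrow> homogeneous g" and A_eq: "A = generated_subalgebra G"
begin

lemma subalgebra_A: "subalgebra A" and G_A: "G \<subseteq> A"
  by (simp_all add: A_eq subalgebra_generated generated_subalgebra_incl)

lemmas P_closed = nonunital_subalgebraD[OF nonunital_positive_part[of A]]

lemma component_generator: "g \<in> G \<Longrightarrow> component n g = (if n = total_degree g then g else 0)"
  by (rule component_hom[OF homogeneous_hom_degree[OF homG]])

lemma positive_part_subset: "positive_part A \<subseteq> A"
  unfolding positive_part_def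
  by (intro hull_minimal subalgebraD(2)[OF subalgebra_A]) auto

lemma component_P: "f \<in> positive_part A \<Longrightarrow> component n f \<in> positive_part A \<and> component 0 f = 0"
proof -
  let ?S = "{f. \<forall>n. component n f \<in> positive_part A \<and> component 0 f = 0}"
  have "positive_part A \<subseteq> ?S"
    unfolding positive_part_def[of A]
  proof (rule hull_minimal)
    show "{f \<in> A. homogeneous f \<and> total_degree f > 0} \<subseteq> {f. \<forall>n. component n f \<in> nonunital_subalgebra hull {f \<in> A. homogeneous f \<and> total_degree f > 0} \<and> component 0 f = 0}"
      unfolding positive_part_def[symmetric]
      by (auto simp: component_hom[OF homogeneous_hom_degree] P_closed positive_part_incl)
    show "nonunital_subalgebra {f. \<forall>n. component n f \<in> nonunital_subalgebra hull {f \<in> A. homogeneous f \<and> total_degree f > 0} \<and> component 0 f = 0}"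
      unfolding positive_part_def[symmetric] nonunital_subalgebra_def mvp.subspace_def
      by (auto simp: component_add component_pscale component_mult pscale_def[of _ 0] intro!: P_closed)
  qed
  then show "f \<in> positive_part A \<Longrightarrow> component n f \<in> positive_part A \<and> component 0 f = 0" by auto
qed

lemma D_subspace: "mvp.subspace (decomposables A)"
  by (simp add: decomposables_def)

lemmas D_closed = mvp.subspace_0[OF D_subspace] mvp.subspace_add[OF D_subspace] mvp.subspace_scale[OF D_subspace]
  mvp.subspace_sum[OF D_subspace]

lemma D_prod: "f \<in> positive_part A \<Longrightarrow> g \<in> positive_part A \<Longrightarrow> f * g \<in> decomposables A"
  unfolding decomposables_def by (intro mvp.span_base) blast

lemma D_minimal:
  assumes "mvp.subspace S" "\<And>f g. f \<in> positive_part A \<Longrightarrow> g \<in> positive_part A \<Longrightarrow> f * g \<in> S"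
  shows "decomposables A \<subseteq> S"
  unfolding decomposables_def using assms by (intro mvp.span_minimal) auto

lemma D_subset_P: "decomposables A \<subseteq> positive_part A"
  using nonunital_positive_part[of A] by (intro D_minimal) (auto simp: nonunital_subalgebra_def)

definition pos_gens :: "('v, 'a) mvpoly set" where "pos_gens = {g \<in> G. total_degree g > 0}"

lemma span_pos_gens_P: "mvp.span (pos_gens \<union> decomposables A) \<subseteq> positive_part A"
  using D_subset_P nonunital_positive_part[of A] G_A
  by (intro mvp.span_minimal) (auto simp: pos_gens_def nonunital_subalgebra_def intro!: positive_part_incl homG)

text \<open>
  A polynomial in the generators is a constant plus a polynomial without constant term, and the latter
  lies in every algebra without unit that contains the generators of positive degree.
\<close>

lemma constant_plus:
  assumes S: "nonunital_subalgebra S" "pos_gens \<subseteq> S" and "f \<in> A"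
  shows "\<exists>c. f - cst c \<in> S"
proof -
  note S_closed = nonunital_subalgebraD[OF S(1)]
  have "generated_subalgebra G \<subseteq> {f. \<exists>c. f - cst c \<in> S}"
  proof (rule generated_subalgebra_minimal)
    show "G \<subseteq> {f. \<exists>c. f - cst c \<in> S}"
    proof
      fix g assume g: "g \<in> G"
      have "\<exists>c. g - cst c \<in> S"
      proof (cases "total_degree g > 0")
        case True
        then have "g - cst 0 \<in> S" using g S(2) by (auto simp: pos_gens_def)
        then show ?thesis by blast
      next
        case False
        then have "g = cst (Poly_Mapping.lookup g 0)"
          using homogeneous_hom_degree[OF homG[OF g]] by (intro hom_degree_zero_cst) simp
        then have "g - cst (Poly_Mapping.lookup g 0) = 0" by (simp only: right_minus_eq)
        then show ?thesis using S_closed(1) by metis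
      qed
      then show "g \<in> {f. \<exists>c. f - cst c \<in> S}" by simp
    qed
    show "subalgebra {f. \<exists>c. f - cst c \<in> S}"
      unfolding subalgebra_def nonunital_subalgebra_def mvp.subspace_def mem_Collect_eq
    proof (intro conjI ballI allI impI)
      show "\<exists>c. 0 - cst c \<in> S" by (rule exI[of _ 0]) (simp add: S_closed)
      show "\<exists>c. 1 - cst c \<in> S" by (rule exI[of _ 1]) (simp add: S_closed)
    next
      fix f g assume "f \<in> {f. \<exists>c. f - cst c \<in> S}" "g \<in> {f. \<exists>c. f - cst c \<in> S}"
      then obtain c d where *: "f - cst c \<in> S" "g - cst d \<in> S" by blast
      have "f + g - cst (c + d) = (f - cst c) + (g - cst d)" by (simp add: single_add)
      then show "\<exists>c. f + g - cst c \<in> S" using * S_closed(2) by metis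
      have "pscale d (f - cst c) + pscale c (g - cst d) + (f - cst c) * (g - cst d) \<in> S"
        using * by (intro S_closed)
      moreover have "pscale d (f - cst c) + pscale c (g - cst d) + (f - cst c) * (g - cst d) = f * g - cst (c * d)"
        by (simp add: pscale_def algebra_simps mult_single)
      ultimately show "\<exists>c. f * g - cst c \<in> S" by auto
    next
      fix r f assume "f \<in> {f. \<exists>c. f - cst c \<in> S}"
      then obtain c where "f - cst c \<in> S" by blast
      moreover have "pscale r f - cst (r * c) = pscale r (f - cst c)"
        by (simp add: pscale_def algebra_simps mult_single)
      ultimately show "\<exists>c. pscale r f - cst c \<in> S" using S_closed(3) by metis
    qed
  qed
  then show ?thesis using assms A_eq by blast
qed

lemma constant_plus_generators:
  assumes "f \<in> A" shows "\<exists>c. f - cst c \<in> mvp.span (pos_gens \<union> decomposables A)"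
proof (rule constant_plus[OF _ _ assms])
  show "nonunital_subalgebra (mvp.span (pos_gens \<union> decomposables A))"
    unfolding nonunital_subalgebra_def using span_pos_gens_P
    by (auto intro!: mvp.span_base[OF UnI2] D_prod)
qed (auto intro: mvp.span_base)

lemma positive_part_minimal:
  assumes "nonunital_subalgebra S" "pos_gens \<subseteq> S" shows "positive_part A \<subseteq> S"
proof
  fix f assume f: "f \<in> positive_part A"
  have "nonunital_subalgebra (S \<inter> positive_part A)" "pos_gens \<subseteq> S \<inter> positive_part A"
    using nonunital_subalgebra_Inter[of "{S, positive_part A}"] assms nonunital_positive_part[of A]
      span_pos_gens_P mvp.span_superset[of "pos_gens \<union> decomposables A"] by auto
  then obtain c where c: "f - cst c \<in> S \<inter> positive_part A"
    using constant_plus f positive_part_subset by blast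
  then have "component 0 (f - cst c) = 0" using component_P by blast
  then have "component 0 (f - cst c + cst c) = cst c"
    by (simp only: component_add component_hom[OF hom_degree_cst]) simp
  then have "cst c = (0 :: ('v, 'a) mvpoly)" using component_P[OF f] by simp
  then show "f \<in> S" using c by simp
qed

lemma component_D: "f \<in> decomposables A \<Longrightarrow> component n f \<in> decomposables A"
proof -
  have "decomposables A \<subseteq> {f. component n f \<in> decomposables A}"
    using component_P
    by (intro D_minimal) (auto simp: mvp.subspace_def component_add component_pscale component_mult
        intro!: D_closed D_prod)
  then show "f \<in> decomposables A \<Longrightarrow> component n f \<in> decomposables A" by auto
qed

text \<open>
  Modulo decomposable elements every element is a constant plus a linear combination of generators.
  Taking components of degree \<open>n\<close>, only the generators of degree \<open>n\<close> matter.
\<close>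

lemma decomposable_in_degree:
  assumes "f \<in> A" "homogeneous f" "total_degree f = n" "n > 0"
    and gens: "\<And>g. g \<in> G \<Longrightarrow> total_degree g = n \<Longrightarrow> g \<in> decomposables A"
  shows "f \<in> decomposables A"
proof -
  obtain c where c: "f - cst c \<in> mvp.span (pos_gens \<union> decomposables A)"
    using constant_plus_generators[OF assms(1)] by blast
  have "mvp.span (pos_gens \<union> decomposables A) \<subseteq> {x. component n x \<in> decomposables A}"
    by (intro mvp.span_minimal) (auto simp: mvp.subspace_def component_add component_pscale component_D
        component_generator pos_gens_def gens intro!: D_closed)
  with c have "component n (f - cst c) \<in> decomposables A" by blast
  moreover have "component n (f - cst c + cst c) = component n (f - cst c) + component n (cst c)"
    by (rule component_add)
  then have "component n (f - cst c) = f"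
    using assms by (simp add: component_hom[OF hom_degree_cst] component_hom[OF homogeneous_hom_degree])
  ultimately show ?thesis by simp
qed

text \<open>
  A decomposable generator \<open>g\<close> is a combination of products of elements of lower degree.
  Those elements are polynomials in the generators in which \<open>g\<close>, for reasons of degree,
  does not occur.
\<close>

lemma redundant_generator:
  assumes "g \<in> G" "total_degree g > 0" "g \<in> decomposables A"
  shows "generated_subalgebra (G - {g}) = A"
proof -
  let ?B = "generated_subalgebra (G - {g})" and ?n = "total_degree g"
  note B = nonunital_subalgebraD[OF subalgebraD(2)[OF subalgebra_generated[of "G - {g}"]]]
  have BG: "G - {g} \<subseteq> ?B" by (rule generated_subalgebra_incl)
  have "generated_subalgebra G \<subseteq> {f. \<forall>m<?n. component m f \<in> ?B}"
  proof (rule generated_subalgebra_minimal)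
    show "G \<subseteq> {f. \<forall>m<?n. component m f \<in> ?B}"
      using BG by (auto simp: component_generator B)
    show "subalgebra {f. \<forall>m<?n. component m f \<in> ?B}"
      unfolding subalgebra_def nonunital_subalgebra_def mvp.subspace_def
      by (auto simp: component_add component_pscale component_mult component_hom[OF hom_degree_one]
          subalgebraD(1)[OF subalgebra_generated] intro!: B)
  qed
  then have low: "component m f \<in> ?B" if "f \<in> A" "m < ?n" for f m
    using that by (auto simp: A_eq)
  have "decomposables A \<subseteq> {f. component ?n f \<in> ?B}"
  proof (rule D_minimal)
    show "mvp.subspace {f. component ?n f \<in> ?B}"
      by (auto simp: mvp.subspace_def component_add component_pscale intro!: B)
    fix f h assume fh: "f \<in> positive_part A" "h \<in> positive_part A"
    have "component i f * component (?n - i) h \<in> ?B" if "i \<le> ?n" for i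
    proof (cases "i = 0 \<or> i = ?n")
      case True then show ?thesis using fh component_P by (auto simp: B)
    next
      case False
      then show ?thesis using fh that positive_part_subset by (intro B low) auto
    qed
    then show "f * h \<in> {f. component ?n f \<in> ?B}"
      unfolding mem_Collect_eq component_mult by (rule B(5)) simp
  qed
  then have "component ?n g \<in> ?B" using assms by blast
  then have "g \<in> ?B" using assms by (simp add: component_generator)
  then have "G \<subseteq> ?B" using BG by blast
  then have "A \<subseteq> ?B" unfolding A_eq by (intro generated_subalgebra_minimal subalgebra_generated)
  moreover have "?B \<subseteq> A"
    using G_A by (intro generated_subalgebra_minimal subalgebra_A) blast
  ultimately show ?thesis by blast
qed

text \<open>
  The graded Nakayama lemma: by induction on the degree, the factors of the decomposable part of an
  element are already polynomials in \<open>B\<close>.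
\<close>

lemma generates_modulo_decomposables:
  assumes "B \<subseteq> pos_gens" "pos_gens \<subseteq> mvp.span (B \<union> decomposables A)"
  shows "generated_subalgebra B = A"
proof
  show "generated_subalgebra B \<subseteq> A"
    using assms G_A by (intro generated_subalgebra_minimal subalgebra_A) (auto simp: pos_gens_def)
  note C = nonunital_subalgebraD[OF subalgebraD(2)[OF subalgebra_generated[of B]]]
  have comp: "component n f \<in> generated_subalgebra B" if "f \<in> A" for f n
    using that
  proof (induction n arbitrary: f rule: less_induct)
    case (less n)
    have "decomposables A \<subseteq> {f. component n f \<in> generated_subalgebra B}"
    proof (rule D_minimal)
      show "mvp.subspace {f. component n f \<in> generated_subalgebra B}"
        by (auto simp: mvp.subspace_def component_add component_pscale intro!: C)
      fix f h assume fh: "f \<in> positive_part A" "h \<in> positive_part A"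
      have "component i f * component (n - i) h \<in> generated_subalgebra B" if "i \<le> n" for i
      proof (cases "i = 0 \<or> i = n")
        case True then show ?thesis using fh component_P by (auto simp: C)
      next
        case False
        then show ?thesis using fh that positive_part_subset by (intro C less.IH) auto
      qed
      then show "f * h \<in> {f. component n f \<in> generated_subalgebra B}"
        unfolding mem_Collect_eq component_mult by (rule C(5)) simp
    qed
    moreover have "B \<subseteq> {f. component n f \<in> generated_subalgebra B}"
    proof
      fix b assume "b \<in> B"
      then have "b \<in> G" "b \<in> generated_subalgebra B"
        using assms(1) generated_subalgebra_incl[of B] by (auto simp: pos_gens_def)
      then show "b \<in> {f. component n f \<in> generated_subalgebra B}"
        by (simp add: component_generator C)
    qed
    ultimately have "mvp.span (B \<union> decomposables A) \<subseteq> {f. component n f \<in> generated_subalgebra B}"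
      by (intro mvp.span_minimal) (auto simp: mvp.subspace_def component_add component_pscale intro!: C)
    moreover obtain c where "f - cst c \<in> mvp.span (pos_gens \<union> decomposables A)"
      using constant_plus_generators[OF less.prems] by blast
    moreover have "mvp.span (pos_gens \<union> decomposables A) \<subseteq> mvp.span (B \<union> decomposables A)"
      using assms(2) by (intro mvp.span_minimal) (auto intro: mvp.span_base)
    ultimately have "component n (f - cst c) \<in> generated_subalgebra B" by blast
    moreover have "component n (cst c) \<in> generated_subalgebra B"
      by (auto simp: component_hom[OF hom_degree_cst] C subalgebra_cst subalgebra_generated)
    ultimately have "component n (f - cst c) + component n (cst c) \<in> generated_subalgebra B"
      by (rule C)
    then show ?case by (simp add: component_add[symmetric])
  qed
  show "A \<subseteq> generated_subalgebra B"
    using comp nonunital_subalgebra_components[OF subalgebraD(2)[OF subalgebra_generated[of B]]] by blast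
qed

text \<open>
  A basis of the decomposable elements is extended by generators to a basis of the span of both. By
  Nakayama the added generators generate, and no proper subset does, because the added generators are
  linearly independent modulo decomposable elements.
\<close>

lemma ex_minimal_generators: "\<exists>B. minimal_homogeneous_generators A B"
proof -
  obtain B0 where B0: "B0 \<subseteq> decomposables A" "mvp.independent B0" "decomposables A \<subseteq> mvp.span B0"
    using mvp.maximal_independent_subset[of "decomposables A"] by metis
  obtain B1 where B1: "B0 \<subseteq> B1" "B1 \<subseteq> B0 \<union> pos_gens" "mvp.independent B1" "B0 \<union> pos_gens \<subseteq> mvp.span B1"
    using mvp.maximal_independent_subset_extend[of B0 "B0 \<union> pos_gens"] B0 by auto
  define B where "B = B1 - B0"
  have BG: "B \<subseteq> pos_gens" using B1 by (auto simp: B_def)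
  have "mvp.span B1 \<subseteq> mvp.span (B \<union> decomposables A)"
    using B0 B1 by (intro mvp.span_mono) (auto simp: B_def)
  then have genB: "generated_subalgebra B = A"
    using BG B1 by (intro generates_modulo_decomposables) auto
  have "generated_subalgebra H \<noteq> A" if H: "H \<subset> B" for H
  proof
    assume genH: "generated_subalgebra H = A"
    interpret H: graded_generators H A
      using genH H BG homG by unfold_locales (auto simp: pos_gens_def)
    obtain g where g: "g \<in> B" "g \<notin> H" using H by blast
    then have gA: "g \<in> A" using BG G_A by (auto simp: pos_gens_def)
    obtain c where c: "g - cst c \<in> mvp.span (H.pos_gens \<union> decomposables A)"
      using H.constant_plus_generators[OF gA] by blast
    then have "component 0 (g - cst c) = 0" using H.span_pos_gens_P component_P by blast
    then have "component 0 (g - cst c + cst c) = cst c"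
      by (simp only: component_add component_hom[OF hom_degree_cst]) simp
    moreover have "component 0 g = 0"
      using g BG component_generator[of g 0] by (auto simp: pos_gens_def)
    ultimately have "g \<in> mvp.span (H.pos_gens \<union> decomposables A)" using c by simp
    moreover have "mvp.span (H.pos_gens \<union> decomposables A) \<subseteq> mvp.span (B1 - {g})"
    proof (intro mvp.span_minimal mvp.subspace_span Un_least)
      show "H.pos_gens \<subseteq> mvp.span (B1 - {g})"
        using H g by (auto simp: H.pos_gens_def B_def intro: mvp.span_base)
      have "mvp.span B0 \<subseteq> mvp.span (B1 - {g})"
        using B1 g by (intro mvp.span_mono) (auto simp: B_def)
      then show "decomposables A \<subseteq> mvp.span (B1 - {g})" using B0 by blast
    qed
    ultimately show False
      using B1(3) g by (auto simp: mvp.dependent_def B_def)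
  qed
  then show ?thesis
    using BG genB homG by (auto simp: minimal_homogeneous_generators_def pos_gens_def)
qed

text \<open>
  Only generators have to be examined in order to bound the degrees of indecomposable elements from
  above, and a single indecomposable element gives the lower bound. In a minimal system no generator of
  positive degree is decomposable, and an indecomposable element of the maximal degree forces a
  generator of that degree.
\<close>

theorem maximal_degree_exists:
  assumes upper: "\<And>g. g \<in> G \<Longrightarrow> total_degree g > N \<Longrightarrow> g \<in> decomposables A"
    and lower: "f \<in> A" "homogeneous f" "f \<notin> decomposables A" "total_degree f \<ge> L" "L > 0"
  shows "\<exists>D. is_D_max A D \<and> (\<exists>B. minimal_homogeneous_generators A B) \<and>
    (\<forall>B. minimal_homogeneous_generators A B \<longrightarrow>
       (\<exists>g\<in>B. total_degree g = D) \<and> (\<forall>g\<in>B. total_degree g \<le> D)) \<and> L \<le> D \<and> D \<le> N"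
proof -
  let ?degs = "{total_degree h | h. h \<in> A \<and> homogeneous h \<and> h \<notin> decomposables A}"
  have bound: "total_degree h \<le> N" if "h \<in> A" "homogeneous h" "h \<notin> decomposables A" for h
    using that upper decomposable_in_degree[OF that(1,2) refl] by (metis bot_nat_0.extremum not_le gr_zeroI)
  then have "?degs \<subseteq> {..N}" by auto
  then have fin: "finite ?degs" by (rule finite_subset) simp
  define D where "D = Max ?degs"
  have "total_degree f \<in> ?degs" using lower by blast
  then have "D \<in> ?degs" and LD: "L \<le> D"
    using Max_in[OF fin] Max_ge[OF fin, of "total_degree f"] lower(4) unfolding D_def by auto
  then obtain h where h: "h \<in> A" "homogeneous h" "h \<notin> decomposables A" "total_degree h = D" by blast
  have maxD: "total_degree k \<le> D" if "k \<in> A" "homogeneous k" "k \<notin> decomposables A" for k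
    unfolding D_def using that by (intro Max_ge[OF fin]) blast
  have "is_D_max A D"
    unfolding is_D_max_def using h maxD by blast
  moreover have "(\<exists>g\<in>B. total_degree g = D) \<and> (\<forall>g\<in>B. total_degree g \<le> D)"
    if "minimal_homogeneous_generators A B" for B
  proof
    interpret B: graded_generators B A
      using that by unfold_locales (auto simp: minimal_homogeneous_generators_def)
    show "\<exists>g\<in>B. total_degree g = D"
      using B.decomposable_in_degree[OF h(1,2,4)] h(3) LD lower(5) by auto
    show "\<forall>g\<in>B. total_degree g \<le> D"
    proof
      fix g assume g: "g \<in> B"
      have "g \<notin> decomposables A" if "total_degree g > 0"
        using B.redundant_generator[OF g that] g \<open>minimal_homogeneous_generators A B\<close>
        unfolding minimal_homogeneous_generators_def by blast
      then show "total_degree g \<le> D"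
        using maxD[of g] g B.G_A B.homG by (cases "total_degree g > 0") auto
    qed
  qed
  moreover have "D \<le> N" using bound h by blast
  ultimately show ?thesis using ex_minimal_generators LD by blast
qed

end

section \<open>Traces of words modulo decomposable elements\<close>

text \<open>
  The letters are the matrices \<open>X k\<close> (flag \<^const>\<open>True\<close>) and their
  transposes.
\<close>

fun letter :: "('d \<Rightarrow> 'r::comm_ring_1 mat3) \<Rightarrow> bool \<times> 'd \<Rightarrow> 'r mat3" where
  "letter X (b, k) = (if b then X k else transp3 (X k))"

definition word :: "('d \<Rightarrow> 'r::comm_ring_1 mat3) \<Rightarrow> (bool \<times> 'd) list \<Rightarrow> 'r mat3" where
  "word X xs = prod_list (map (letter X) xs)"

lemma word_simps [simp]:
  "word X [] = 1" "word X (x # xs) = letter X x * word X xs" "word X (xs @ ys) = word X xs * word X ys"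
  by (simp_all add: word_def)

lemma transp3_letter: "transp3 (letter X x) = letter X (\<not> fst x, snd x)"
  by (cases x) simp

lemma transp3_word: "transp3 (word X xs) = word X (rev (map (\<lambda>x. (\<not> fst x, snd x)) xs))"
  by (induction xs) (simp_all add: transp3_letter)

lemma det3_letter: "det3 (letter X x) = det3 (X (snd x))"
  by (cases x) (simp add: det3_transp)

text \<open>
  The set \<open>P\<close> plays the role of the elements of positive degree of the algebra of
  invariants and \<open>Dc\<close> the role of the decomposable elements; \<open>hf\<close> is the
  scalar \<open>1/2\<close>. The grading is not visible here: that a trace is decomposable is derived
  from identities between matrices alone.
\<close>

locale trace_ring =
  fixes P Dc :: "'r::comm_ring_1 set" and hf :: 'r and X :: "'d::finite \<Rightarrow> 'r mat3"
  assumes half: "2 * hf = 1"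
    and P_add: "\<And>p q. p \<in> P \<Longrightarrow> q \<in> P \<Longrightarrow> p + q \<in> P"
    and P_uminus: "\<And>p. p \<in> P \<Longrightarrow> - p \<in> P"
    and P_half: "\<And>p. p \<in> P \<Longrightarrow> hf * p \<in> P"
    and P_mult: "\<And>p q. p \<in> P \<Longrightarrow> q \<in> P \<Longrightarrow> p * q \<in> P"
    and D_add: "\<And>p q. p \<in> Dc \<Longrightarrow> q \<in> Dc \<Longrightarrow> p + q \<in> Dc"
    and D_uminus: "\<And>p. p \<in> Dc \<Longrightarrow> - p \<in> Dc"
    and D_half: "\<And>p. p \<in> Dc \<Longrightarrow> hf * p \<in> Dc"
    and D_zero: "0 \<in> Dc"
    and D_subset: "Dc \<subseteq> P"
    and D_prod: "\<And>p q. p \<in> P \<Longrightarrow> q \<in> P \<Longrightarrow> p * q \<in> Dc"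
    and tr_word: "\<And>xs. xs \<noteq> [] \<Longrightarrow> tr3 (word X xs) \<in> P"
    and det_X: "\<And>k. det3 (X k) \<in> P"
begin

lemma P_diff: "p \<in> P \<Longrightarrow> q \<in> P \<Longrightarrow> p - q \<in> P"
  using P_add[of p "- q"] P_uminus by simp

lemma D_diff: "p \<in> Dc \<Longrightarrow> q \<in> Dc \<Longrightarrow> p - q \<in> Dc"
  using D_add[of p "- q"] D_uminus by simp

lemma P_zero: "0 \<in> P"
  using D_zero D_subset by blast

lemma half_cancel: "hf * (p + p) = p"
proof -
  have "hf * (p + p) = (2 * hf) * p" by (simp add: algebra_simps)
  then show ?thesis using half by simp
qed

lemma D_twice: "p + p \<in> Dc \<Longrightarrow> p \<in> Dc"
  using D_half[of "p + p"] by (simp only: half_cancel)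

text \<open>
  The matrices obtained from nonempty words with scalars from \<open>P\<close> and the scalar
  \<open>1/2\<close>. The scalars from \<open>P\<close> are needed for closure under operations whose
  coefficients are traces, such as passing from the axis of a skew-symmetric matrix to its image under
  another matrix.
\<close>

inductive_set mat_alg :: "'r mat3 set" where
  mat_alg_word: "xs \<noteq> [] \<Longrightarrow> word X xs \<in> mat_alg"
| mat_alg_add: "A \<in> mat_alg \<Longrightarrow> B \<in> mat_alg \<Longrightarrow> A + B \<in> mat_alg"
| mat_alg_uminus: "A \<in> mat_alg \<Longrightarrow> - A \<in> mat_alg"
| mat_alg_half: "A \<in> mat_alg \<Longrightarrow> smul hf A \<in> mat_alg"
| mat_alg_smul: "A \<in> mat_alg \<Longrightarrow> p \<in> P \<Longrightarrow> smul p A \<in> mat_alg"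

lemma mat_alg_diff: "A \<in> mat_alg \<Longrightarrow> B \<in> mat_alg \<Longrightarrow> A - B \<in> mat_alg"
  using mat_alg_add[of A "- B"] mat_alg_uminus by simp

lemma mat_alg_mult:
  assumes "A \<in> mat_alg" "B \<in> mat_alg"
  shows "A * B \<in> mat_alg"
  using assms(1)
proof induction
  case (mat_alg_word xs)
  show ?case using assms(2)
  proof induction
    case (mat_alg_word ys)
    then show ?case using mat_alg.mat_alg_word[of "xs @ ys"] by simp
  qed (auto simp: distrib_left smul_simps intro: mat_alg.intros)
qed (auto simp: distrib_right smul_simps intro: mat_alg.intros)

lemma mat_alg_transp: "A \<in> mat_alg \<Longrightarrow> transp3 A \<in> mat_alg"
  by (induction rule: mat_alg.induct) (auto simp: transp3_word intro: mat_alg.intros)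

lemma tr_mat_alg: "A \<in> mat_alg \<Longrightarrow> tr3 A \<in> P"
  by (induction rule: mat_alg.induct) (auto intro: tr_word P_add P_uminus P_half P_mult)

lemma minors_mat_alg:
  assumes "A \<in> mat_alg" shows "minors3 A \<in> P"
proof -
  have "minors3 A = hf * (minors3 A + minors3 A)" by (simp only: half_cancel)
  also have "minors3 A + minors3 A = tr3 A * tr3 A - tr3 (A * A)"
    by (simp only: twice_minors3[symmetric] mult_2)
  finally show ?thesis
    using assms by (simp add: P_half P_diff P_mult tr_mat_alg mat_alg_mult)
qed

lemma det_word: "xs \<noteq> [] \<Longrightarrow> det3 (word X xs) \<in> P"
proof (induction xs rule: list_nonempty_induct)
  case (single x) then show ?case by (simp add: det3_letter det_X)
next
  case (cons x xs) then show ?case by (simp add: det3_letter det3_mult det_X P_mult)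
qed

lemma det_mat_alg: "A \<in> mat_alg \<Longrightarrow> det3 A \<in> P"
proof (induction rule: mat_alg.induct)
  case (mat_alg_word xs) then show ?case by (rule det_word)
next
  case (mat_alg_add A B)
  then show ?case unfolding det3_add
    by (intro P_add P_diff P_mult tr_mat_alg minors_mat_alg mat_alg_mult) auto
next
  case (mat_alg_uminus A)
  have "det3 (- A) = - det3 A" by (cases A) (simp add: algebra_simps)
  then show ?case using mat_alg_uminus by (simp add: P_uminus)
next
  case (mat_alg_half A)
  then show ?case by (simp add: det3_smul power3_eq_cube mult.assoc P_half)
next
  case (mat_alg_smul A p)
  then show ?case by (simp add: det3_smul power3_eq_cube mult.assoc P_mult)
qed

lemma letter_mat_alg: "letter X x \<in> mat_alg"
  using mat_alg_word[of "[x]"] by simp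

text \<open>
  The matrices that may be replaced by zero inside a longer word.
\<close>

definition trace_null :: "'r mat3 \<Rightarrow> bool" where
  "trace_null A \<longleftrightarrow> (\<forall>C\<in>mat_alg. tr3 (A * C) \<in> Dc)"

lemma trace_nullI: "(\<And>C. C \<in> mat_alg \<Longrightarrow> tr3 (A * C) \<in> Dc) \<Longrightarrow> trace_null A"
  and trace_nullD: "trace_null A \<Longrightarrow> C \<in> mat_alg \<Longrightarrow> tr3 (A * C) \<in> Dc"
  by (auto simp: trace_null_def)

lemma trace_null_add: "trace_null A \<Longrightarrow> trace_null B \<Longrightarrow> trace_null (A + B)"
  by (auto simp: trace_null_def distrib_right D_add)

lemma trace_null_uminus: "trace_null A \<Longrightarrow> trace_null (- A)"
  by (auto simp: trace_null_def D_uminus)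

lemma trace_null_diff: "trace_null A \<Longrightarrow> trace_null B \<Longrightarrow> trace_null (A - B)"
  using trace_null_add[of A "- B"] trace_null_uminus by simp

lemma trace_null_mult_right: "trace_null A \<Longrightarrow> B \<in> mat_alg \<Longrightarrow> trace_null (A * B)"
  by (auto simp: trace_null_def mult.assoc mat_alg_mult)

lemma trace_null_mult_left: "trace_null A \<Longrightarrow> B \<in> mat_alg \<Longrightarrow> trace_null (B * A)"
proof (rule trace_nullI)
  fix C assume *: "trace_null A" "B \<in> mat_alg" "C \<in> mat_alg"
  have "tr3 (B * A * C) = tr3 (A * (C * B))"
    using tr3_mult_commute[of B "A * C"] by (simp add: mult.assoc)
  then show "tr3 (B * A * C) \<in> Dc" using * by (simp add: trace_nullD mat_alg_mult)
qed

lemma trace_null_twice: "trace_null (A + A) \<Longrightarrow> trace_null A"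
  by (auto simp: trace_null_def distrib_right intro: D_twice)

text \<open>
  By Cayley and Hamilton the cube of \<open>A\<close> is a combination of lower powers of
  \<open>A\<close> with coefficients in \<open>P\<close>.
\<close>

lemma trace_null_cube:
  assumes "A \<in> mat_alg" shows "trace_null (A * A * A)"
proof (rule trace_nullI)
  fix C assume C: "C \<in> mat_alg"
  show "tr3 (A * A * A * C) \<in> Dc"
    unfolding cayley_hamilton3 using assms C
    by (simp add: algebra_simps smul_simps)
      (simp add: D_add D_diff D_prod tr_mat_alg minors_mat_alg det_mat_alg mat_alg_mult flip: mult.assoc)
qed

definition polar :: "'r mat3 \<Rightarrow> 'r mat3 \<Rightarrow> 'r mat3" where
  "polar x y = x * x * y + x * y * x + y * x * x"

text \<open>
  The part of \<open>(x + y)\<^sup>3\<close> that is linear in \<open>y\<close>, isolated by means of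
  \<open>x + y\<close> and \<open>x - y\<close>.
\<close>

lemma trace_null_polar:
  assumes "x \<in> mat_alg" "y \<in> mat_alg" shows "trace_null (polar x y)"
proof (rule trace_null_twice)
  have "polar x y + polar x y = (x + y) * (x + y) * (x + y) - (x - y) * (x - y) * (x - y) - (y * y * y + y * y * y)"
    by (simp add: polar_def algebra_simps)
  also have "trace_null \<dots>"
    using assms by (intro trace_null_diff trace_null_add trace_null_cube mat_alg_add mat_alg_diff)
  finally show "trace_null (polar x y + polar x y)" .
qed

section \<open>Long traces when two and three are invertible\<close>

context
  assumes D_thrice: "\<And>p. p + p + p \<in> Dc \<Longrightarrow> p \<in> Dc"
begin

lemma trace_null_thrice: "trace_null (A + A + A) \<Longrightarrow> trace_null A"
  by (auto simp: trace_null_def distrib_right intro: D_thrice)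

text \<open>
  Higman's computation: the sum of \<open>x\<^sup>i z y\<^sup>j x\<^bsup>2-i\<^esup>
  y\<^bsup>2-j\<^esup>\<close> over \<open>0 \<le> i, j \<le> 2\<close> vanishes when it is summed over
  \<open>i\<close> first, and it equals \<open>3 x\<^sup>2 z y\<^sup>2\<close> when it is summed over
  \<open>j\<close> first.
\<close>

lemma trace_null_sq_sq:
  assumes "x \<in> mat_alg" "z \<in> mat_alg" "y \<in> mat_alg" shows "trace_null (x * x * z * (y * y))"
proof (rule trace_null_thrice)
  have "x * x * z * (y * y) + x * x * z * (y * y) + x * x * z * (y * y)
    = polar x z * (y * y) + polar x (z * y) * y + polar x (z * y * y) - z * polar y (x * x) - x * z * polar y x"
    by (simp add: polar_def algebra_simps)
  also have "trace_null \<dots>"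
    using assms by (intro trace_null_diff trace_null_add trace_null_mult_right trace_null_mult_left trace_null_polar mat_alg_mult)
  finally show "trace_null (x * x * z * (y * y) + x * x * z * (y * y) + x * x * z * (y * y))" .
qed

definition jordan :: "'r mat3 \<Rightarrow> 'r mat3 \<Rightarrow> 'r mat3" where
  "jordan a b = a * b + b * a"

lemma jordan_squares: "jordan a b = (a + b) * (a + b) - a * a - b * b"
  by (simp add: jordan_def algebra_simps)

lemma trace_null_jordan_jordan:
  assumes "a \<in> mat_alg" "b \<in> mat_alg" "z \<in> mat_alg" "c \<in> mat_alg" "d \<in> mat_alg"
  shows "trace_null (jordan a b * z * jordan c d)"
proof -
  have *: "trace_null (jordan a b * z * (y * y))" if "y \<in> mat_alg" for y
    using assms that unfolding jordan_squares left_diff_distrib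
    by (intro trace_null_diff trace_null_sq_sq mat_alg_add)
  show ?thesis
    unfolding jordan_squares[of c d] right_diff_distrib
    using assms by (intro trace_null_diff * mat_alg_add)
qed

text \<open>
  After \<open>jordan a b * c\<close> every \<open>jordan u v\<close> may be replaced by zero, even with
  further factors in between; and in a ring where all squares vanish, twice a product of three factors
  vanishes.
\<close>

lemma trace_null_jordan_four:
  assumes "a \<in> mat_alg" "b \<in> mat_alg" "c \<in> mat_alg" "d \<in> mat_alg" "e \<in> mat_alg" "f \<in> mat_alg"
  shows "trace_null (jordan a b * c * (d * e * f))"
proof (rule trace_null_twice)
  have "jordan a b * c * (d * e * f) + jordan a b * c * (d * e * f)
    = jordan a b * c * jordan d e * f - jordan a b * (c * e) * jordan d f + jordan a b * c * jordan (e * f) d"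
    by (simp add: jordan_def algebra_simps)
  also have "trace_null \<dots>"
    using assms by (intro trace_null_add trace_null_diff trace_null_mult_right trace_null_jordan_jordan mat_alg_mult)
  finally show "trace_null (jordan a b * c * (d * e * f) + jordan a b * c * (d * e * f))" .
qed

lemma tr_cyclic: "tr3 (prod_list (xs @ ys)) = tr3 (prod_list (ys @ xs))"
  by (simp add: tr3_mult_commute)

lemma length_five: "length xs = 5 \<Longrightarrow> \<exists>c d e f g. xs = [c, d, e, f, g]"
  by (auto simp: length_Suc_conv numeral_eq_Suc)

text \<open>
  By \<open>trace_null_jordan_four\<close>, the first two of seven cyclically arranged factors
  anticommute.
\<close>

lemma tr_seven_swap:
  assumes "length (ys @ a # b # zs) = 7" "set (ys @ a # b # zs) \<subseteq> mat_alg"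
  shows "tr3 (prod_list (ys @ a # b # zs)) + tr3 (prod_list (ys @ b # a # zs)) \<in> Dc"
proof -
  have "length (zs @ ys) = 5" using assms by simp
  then obtain c d e f g where cs: "zs @ ys = [c, d, e, f, g]"
    using length_five by blast
  have in_mat_alg: "set [a, b, c, d, e, f, g] \<subseteq> mat_alg"
    using assms(2) unfolding cs[symmetric] by (simp add: cs[symmetric])
  have "tr3 (prod_list (ys @ a # b # zs)) = tr3 (a * b * prod_list (zs @ ys))"
       "tr3 (prod_list (ys @ b # a # zs)) = tr3 (b * a * prod_list (zs @ ys))"
    using tr_cyclic[of ys "a # b # zs"] tr_cyclic[of ys "b # a # zs"] by (simp_all add: mult.assoc)
  moreover have "tr3 (jordan a b * c * (d * e * f) * g) \<in> Dc"
    using in_mat_alg by (intro trace_nullD trace_null_jordan_four) auto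
  ultimately show ?thesis
    by (simp add: cs jordan_def algebra_simps)
qed

lemma tr_seven_block_swap:
  assumes "length (ys @ [a, b, c, d] @ zs) = 7" "set (ys @ [a, b, c, d] @ zs) \<subseteq> mat_alg"
  shows "tr3 (prod_list (ys @ [a, b, c, d] @ zs)) - tr3 (prod_list (ys @ [c, d, a, b] @ zs)) \<in> Dc"
proof -
  let ?t = "\<lambda>xs. tr3 (prod_list xs)"
  have 1: "?t (ys @ [a, b, c, d] @ zs) + ?t (ys @ [a, c, b, d] @ zs) \<in> Dc"
    using tr_seven_swap[of "ys @ [a]" b c "d # zs"] assms by simp
  have 2: "?t (ys @ [a, c, b, d] @ zs) + ?t (ys @ [c, a, b, d] @ zs) \<in> Dc"
    using tr_seven_swap[of "ys" a c "b # d # zs"] assms by simp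
  have 3: "?t (ys @ [c, a, b, d] @ zs) + ?t (ys @ [c, a, d, b] @ zs) \<in> Dc"
    using tr_seven_swap[of "ys @ [c, a]" b d "zs"] assms by simp
  have 4: "?t (ys @ [c, a, d, b] @ zs) + ?t (ys @ [c, d, a, b] @ zs) \<in> Dc"
    using tr_seven_swap[of "ys @ [c]" a d "b # zs"] assms by simp
  show ?thesis
    using D_diff[OF D_add[OF D_diff[OF 1 2] 3] 4] by (simp add: algebra_simps)
qed

lemma D_six_congruent:
  assumes "a + b + c + d + e + f \<in> Dc" "a - b \<in> Dc" "a - c \<in> Dc" "b - d \<in> Dc" "c - e \<in> Dc" "e - f \<in> Dc"
  shows "a \<in> Dc"
proof -
  have "(a + a + a) + (a + a + a)
    = (a + b + c + d + e + f) + (a - b) + (a - c) + ((a - b) + (b - d)) + ((a - c) + (c - e))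
      + ((a - c) + (c - e) + (e - f))"
    by (simp add: algebra_simps)
  also have "\<dots> \<in> Dc"
    by (rule assms D_add)+
  finally show ?thesis
    by (rule D_thrice[OF D_twice])
qed

text \<open>
  The trace of a product of seven factors changes sign under transpositions, hence is invariant under
  permutations of the three blocks \<open>a b\<close>, \<open>c d\<close>, \<open>e f\<close> of even
  length. The fully polarised identity \<open>x\<^sup>3 = 0\<close>, applied to these blocks, therefore
  yields six times the trace.
\<close>

lemma tr_seven:
  assumes "set [a, b, c, d, e, f, g] \<subseteq> mat_alg"
  shows "tr3 (prod_list [a, b, c, d, e, f, g]) \<in> Dc"
proof -
  let ?t = "\<lambda>xs. tr3 (prod_list xs)"
  let ?T = "?t [a, b, c, d, e, f, g]"
  have 1: "?T - ?t [c, d, a, b, e, f, g] \<in> Dc"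
    using tr_seven_block_swap[of "[]" a b c d "[e, f, g]"] assms by simp
  have 2: "?T - ?t [a, b, e, f, c, d, g] \<in> Dc"
    using tr_seven_block_swap[of "[a, b]" c d e f "[g]"] assms by simp
  have 3: "?t [c, d, a, b, e, f, g] - ?t [c, d, e, f, a, b, g] \<in> Dc"
    using tr_seven_block_swap[of "[c, d]" a b e f "[g]"] assms by simp
  have 4: "?t [a, b, e, f, c, d, g] - ?t [e, f, a, b, c, d, g] \<in> Dc"
    using tr_seven_block_swap[of "[]" a b e f "[c, d, g]"] assms by simp
  have 5: "?t [e, f, a, b, c, d, g] - ?t [e, f, c, d, a, b, g] \<in> Dc"
    using tr_seven_block_swap[of "[e, f]" a b c d "[g]"] assms by simp
  \<comment> \<open>The polarisation of \<open>x\<^sup>3\<close> at the three blocks: the sum of the six products in all orders.\<close>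
  let ?x = "a * b" and ?y = "c * d" and ?z = "e * f"
  have "trace_null (polar (?x + ?y) ?z - polar ?x ?z - polar ?y ?z)"
    using assms by (intro trace_null_diff trace_null_polar mat_alg_add mat_alg_mult) auto
  then have "tr3 ((polar (?x + ?y) ?z - polar ?x ?z - polar ?y ?z) * g) \<in> Dc"
    using assms by (intro trace_nullD) auto
  moreover have "tr3 ((polar (?x + ?y) ?z - polar ?x ?z - polar ?y ?z) * g)
    = ?T + ?t [c, d, a, b, e, f, g] + ?t [a, b, e, f, c, d, g] + ?t [c, d, e, f, a, b, g]
      + ?t [e, f, a, b, c, d, g] + ?t [e, f, c, d, a, b, g]" (is "_ = ?rhs")
    by (simp add: polar_def algebra_simps)
  ultimately have "?rhs \<in> Dc" by simp
  from D_six_congruent[OF this 1 2 3 4 5] show ?thesis .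
qed

theorem tr_long_word_coprime_6:
  assumes "length xs \<ge> 7"
  shows "tr3 (word X xs) \<in> Dc"
proof -
  obtain a b c d e f ys where xs: "xs = a # b # c # d # e # f # ys" and "ys \<noteq> []"
  proof -
    obtain a b c d e f g zs where "xs = a # b # c # d # e # f # g # zs"
      using assms by (auto simp: Suc_le_length_iff numeral_eq_Suc)
    then show thesis using that by blast
  qed
  then have "set [letter X a, letter X b, letter X c, letter X d, letter X e, letter X f, word X ys] \<subseteq> mat_alg"
    by (simp add: letter_mat_alg mat_alg_word)
  from tr_seven[OF this] show ?thesis by (simp add: xs mult.assoc)
qed

end

end

section \<open>Sorting letters\<close>

lemma swap_to_front:
  fixes g :: "'k list \<Rightarrow> 'r::ab_group_add"
  assumes D0: "0 \<in> D" and Dadd: "\<And>p q. p \<in> D \<Longrightarrow> q \<in> D \<Longrightarrow> p + q \<in> D"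
    and sw: "\<And>ys i j zs. length (ys @ i # j # zs) = n \<Longrightarrow> g (ys @ i # j # zs) - g (ys @ j # i # zs) \<in> D"
    and "length (pre @ as @ x # bs) = n"
  shows "g (pre @ as @ x # bs) - g (pre @ x # as @ bs) \<in> D"
  using assms(4)
proof (induction as arbitrary: bs rule: rev_induct)
  case Nil then show ?case by (simp add: D0)
next
  case (snoc a as)
  have 1: "g ((pre @ as) @ a # x # bs) - g ((pre @ as) @ x # a # bs) \<in> D"
    using snoc.prems by (intro sw) simp
  have 2: "g (pre @ as @ x # a # bs) - g (pre @ x # as @ a # bs) \<in> D"
    using snoc.prems by (intro snoc.IH) simp
  show ?case
    using Dadd[OF 1 2] by simp
qed

lemma mset_eq_congruent:
  fixes g :: "'k list \<Rightarrow> 'r::ab_group_add"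
  assumes D0: "0 \<in> D" and Dadd: "\<And>p q. p \<in> D \<Longrightarrow> q \<in> D \<Longrightarrow> p + q \<in> D"
    and sw: "\<And>ys i j zs. length (ys @ i # j # zs) = n \<Longrightarrow> g (ys @ i # j # zs) - g (ys @ j # i # zs) \<in> D"
    and "length (pre @ xs) = n" "mset xs = mset ys"
  shows "g (pre @ ys) - g (pre @ xs) \<in> D"
  using assms(4,5)
proof (induction xs arbitrary: pre ys)
  case Nil then show ?case by (simp add: D0)
next
  case (Cons x xs)
  from Cons.prems(2) have "x \<in> set ys" by (metis list.set_intros(1) set_mset_mset)
  then obtain as bs where ys: "ys = as @ x # bs" by (meson split_list)
  have ms: "mset xs = mset (as @ bs)" using Cons.prems(2) by (simp add: ys)
  then have len: "length (as @ bs) = length xs" by (metis size_mset)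
  have 1: "g (pre @ as @ x # bs) - g (pre @ x # as @ bs) \<in> D"
    by (rule swap_to_front[where D = D and g = g and n = n]) (use D0 Dadd sw Cons.prems(1) len in auto)
  have 2: "g ((pre @ [x]) @ (as @ bs)) - g ((pre @ [x]) @ xs) \<in> D"
    using Cons.prems(1) ms by (intro Cons.IH) auto
  show ?case
    using Dadd[OF 1 2] by (simp add: ys)
qed

lemma triple_letter_exists:
  fixes xs :: "'k::finite list"
  assumes "length xs > 2 * CARD('k)"
  obtains k ys where "mset xs = mset (k # k # k # ys)"
proof -
  have "\<exists>k. count (mset xs) k \<ge> 3"
  proof (rule ccontr)
    assume "\<not> ?thesis"
    then have "count (mset xs) k \<le> 2" for k
      using not_less_eq_eq[of 2 "count (mset xs) k"] \<open>\<not> (\<exists>k. count (mset xs) k \<ge> 3)\<close>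
      by (metis eval_nat_numeral(3) le_SucE nle_le)
    then have "(\<Sum>k\<in>UNIV. count (mset xs) k) \<le> (\<Sum>k\<in>(UNIV::'k set). 2)"
      by (intro sum_mono) auto
    moreover have "(\<Sum>k\<in>UNIV. count (mset xs) k) = length xs"
      unfolding size_mset[symmetric] size_multiset_overloaded_eq
      by (rule sum.mono_neutral_right) (auto simp: count_eq_zero_iff)
    ultimately show False using assms by simp
  qed
  then obtain k where "count (mset xs) k \<ge> 3" by blast
  then have "replicate_mset 3 k \<subseteq># mset xs" by (simp only: count_le_replicate_mset_subset_eq)
  then obtain M where M: "mset xs = replicate_mset 3 k + M" by (blast elim: subset_mset.lessE dest: mset_subset_eq_exists_conv[THEN iffD1])
  obtain ys where ys: "mset ys = M" using ex_mset[of M] by blast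
  show thesis using that[of k ys] by (simp add: M ys numeral_eq_Suc)
qed

text \<open>
  If adjacent letters commute and cubes of letters vanish, then a word in which each of the
  \<open>n\<close> letters may occur at most twice has length at most \<open>2 n\<close>.
\<close>

lemma long_words_vanish:
  fixes g :: "'k::finite list \<Rightarrow> 'r::ab_group_add"
  assumes D0: "0 \<in> D" and Dadd: "\<And>p q. p \<in> D \<Longrightarrow> q \<in> D \<Longrightarrow> p + q \<in> D"
    and sw: "\<And>ys i j zs. length (ys @ i # j # zs) = length xs \<Longrightarrow>
      g (ys @ i # j # zs) - g (ys @ j # i # zs) \<in> D"
    and cube: "\<And>k zs. length (k # k # k # zs) = length xs \<Longrightarrow> g (k # k # k # zs) \<in> D"
    and long: "length xs > 2 * CARD('k)"
  shows "g xs \<in> D"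
proof -
  obtain k ys where ms: "mset xs = mset (k # k # k # ys)" using triple_letter_exists[OF long] .
  then have len: "length (k # k # k # ys) = length xs" by (metis size_mset)
  have "g ([] @ xs) - g ([] @ k # k # k # ys) \<in> D"
    by (rule mset_eq_congruent[where D = D and g = g and n = "length xs"]) (use D0 Dadd sw len ms in auto)
  from Dadd[OF this cube[OF len]] show ?thesis by simp
qed

text \<open>
  Here \<open>f \<alpha> \<beta> \<gamma>\<close> stands for a monomial in commuting variables, where
  each letter \<open>k\<close> has one variable \<open>k\<^sub>1\<close>, \<open>k\<^sub>2\<close>,
  \<open>k\<^sub>3\<close> for each of three slots. The assumptions say that \<open>k\<^sub>1 +
  k\<^sub>2 + k\<^sub>3\<close>, \<open>k\<^sub>1 l\<^sub>1 + k\<^sub>2 l\<^sub>2 + k\<^sub>3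
  l\<^sub>3\<close> and \<open>k\<^sub>1\<^sup>3\<close> vanish. The first relation removes the third
  slot. The second one then expresses a product of two letters in the second slot through monomials with
  fewer letters there. What is left has at most one letter in the second slot, hence more than \<open>2
  n\<close> letters in the first one, so that some cube occurs there.
\<close>

lemma three_slots_vanish:
  fixes f :: "'k::finite list \<Rightarrow> 'k list \<Rightarrow> 'k list \<Rightarrow> 'r::comm_ring_1"
  assumes D0: "0 \<in> D" and Dadd: "\<And>p q. p \<in> D \<Longrightarrow> q \<in> D \<Longrightarrow> p + q \<in> D"
    and Duminus: "\<And>p. p \<in> D \<Longrightarrow> - p \<in> D" and Dtwice: "\<And>p. p + p \<in> D \<Longrightarrow> p \<in> D"
    and sw: "\<And>ys i j zs \<beta> \<gamma>. f (ys @ i # j # zs) \<beta> \<gamma> - f (ys @ j # i # zs) \<beta> \<gamma> \<in> D"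
    and sw': "\<And>i j zs \<alpha> \<gamma>. f \<alpha> (i # j # zs) \<gamma> - f \<alpha> (j # i # zs) \<gamma> \<in> D"
    and cube: "\<And>k zs \<beta> \<gamma>. f (k # k # k # zs) \<beta> \<gamma> \<in> D"
    and slot: "\<And>k \<alpha> \<beta> \<gamma>. f (k # \<alpha>) \<beta> \<gamma> + f \<alpha> (k # \<beta>) \<gamma> + f \<alpha> \<beta> (k # \<gamma>) \<in> D"
    and pair: "\<And>k l \<alpha> \<beta> \<gamma>. f (k # l # \<alpha>) \<beta> \<gamma> + f \<alpha> (k # l # \<beta>) \<gamma> + f \<alpha> \<beta> (k # l # \<gamma>) \<in> D"
    and long: "length \<alpha> + length \<beta> + length \<gamma> \<ge> 2 * CARD('k) + 2"
  shows "f \<alpha> \<beta> \<gamma> \<in> D"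
  using long
proof (induction \<gamma> arbitrary: \<alpha> \<beta>)
  case (Cons k \<gamma>)
  have "f (k # \<alpha>) \<beta> \<gamma> \<in> D" "f \<alpha> (k # \<beta>) \<gamma> \<in> D"
    using Cons by simp_all
  then have "- (f (k # \<alpha>) \<beta> \<gamma> + f \<alpha> (k # \<beta>) \<gamma>) \<in> D" by (intro Duminus Dadd)
  from Dadd[OF this slot[of k \<alpha> \<beta> \<gamma>]] show ?case by (simp add: algebra_simps)
next
  case Nil
  then show ?case
  proof (induction "length \<beta>" arbitrary: \<alpha> \<beta> rule: less_induct)
    case less
    show ?case
    proof (cases "length \<beta> < 2")
      case True
      with less.prems have "length \<alpha> > 2 * CARD('k)" by simp
      then show ?thesis
        by (intro long_words_vanish[where D = D and xs = \<alpha> and g = "\<lambda>\<alpha>. f \<alpha> \<beta> []"] D0 Dadd sw cube)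
    next
      case False
      then obtain k l \<beta>' where b: "\<beta> = k # l # \<beta>'"
        by (auto simp: not_less numeral_2_eq_2 Suc_le_length_iff)
      let ?A = "f (k # l # \<alpha>) \<beta>' []" and ?B = "f (l # \<alpha>) (k # \<beta>') []" and ?C = "f (k # \<alpha>) (l # \<beta>') []"
      have A: "?A \<in> D" and B: "?B \<in> D" and C: "?C \<in> D"
        using less.prems by (simp_all add: less.hyps b)
      \<comment> \<open>All terms with fewer letters in the second slot vanish by induction. Modulo these, \<open>?e\<close> is
        \<open>- ?a\<close> by the relation for pairs, and it is \<open>?a'\<close> when its two letters are moved one
        at a time; and \<open>?a\<close> is \<open>?a'\<close> up to the order of two letters.\<close>
      let ?a = "f \<alpha> \<beta> []" and ?a' = "f \<alpha> (l # k # \<beta>') []" and ?e = "f \<alpha> \<beta>' [k, l]"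
      have "?a + ?e \<in> D"
        using Dadd[OF pair[of k l \<alpha> \<beta>' "[]"] Duminus[OF A]] by (simp add: b)
      moreover have "f (k # \<alpha>) \<beta>' [l] + f \<alpha> (k # \<beta>') [l] + ?e \<in> D"
        using slot[of k \<alpha> \<beta>' "[l]"] by simp
      moreover have "f (k # \<alpha>) \<beta>' [l] \<in> D"
      proof -
        have "f (l # k # \<alpha>) \<beta>' [] \<in> D"
          using Dadd[OF sw[of "[]" l k \<alpha> \<beta>' "[]"] A] by simp
        then have "- (f (l # k # \<alpha>) \<beta>' [] + ?C) \<in> D"
          using C by (intro Duminus Dadd)
        from Dadd[OF this slot[of l "k # \<alpha>" \<beta>' "[]"]] show ?thesis by (simp add: algebra_simps)
      qed
      moreover have "?B + ?a' + f \<alpha> (k # \<beta>') [l] \<in> D"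
        using slot[of l \<alpha> "k # \<beta>'" "[]"] by simp
      moreover have "?a - ?a' \<in> D"
        unfolding b by (rule sw')
      ultimately have "(?a + ?e) + - (f (k # \<alpha>) \<beta>' [l] + f \<alpha> (k # \<beta>') [l] + ?e) + f (k # \<alpha>) \<beta>' [l]
          + (?B + ?a' + f \<alpha> (k # \<beta>') [l]) + - ?B + (?a - ?a') \<in> D"
        using B by - (assumption | rule Dadd Duminus)+
      then show ?thesis
        by - (rule Dtwice, simp add: algebra_simps)
    qed
  qed
qed

section \<open>Skew-symmetric factors and their axes\<close>

context trace_ring
begin

text \<open>
  Axes of skew-symmetric matrices replace those matrices: they carry an action of
  \<^const>\<open>mat_alg\<close>, and scalar and triple products of axes are traces.
\<close>

definition axial_vectors :: "'r vec3 set" where "axial_vectors = {v. hat v \<in> mat_alg}"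

fun axial :: "'r mat3 \<Rightarrow> 'r vec3" where
  "axial (Mat3 a b c d e f g h i) = Vec3 (h - f) (c - g) (d - b)"

lemma hat_axial: "hat (axial A) = A - transp3 A"
  by (cases A) simp

lemma axial_axial_vectors: "A \<in> mat_alg \<Longrightarrow> axial A \<in> axial_vectors"
  by (simp add: axial_vectors_def hat_axial mat_alg_diff mat_alg_transp)

lemma app3_axial_vectors:
  assumes "A \<in> mat_alg" "v \<in> axial_vectors" shows "app3 A v \<in> axial_vectors"
proof -
  have "hat (app3 A v) = smul (tr3 A) (hat v) - hat v * A - transp3 A * hat v"
    using hat_mult[of v A] by (simp add: algebra_simps)
  then show ?thesis
    using assms by (simp add: axial_vectors_def mat_alg_diff mat_alg_smul mat_alg_mult mat_alg_transp tr_mat_alg)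
qed

lemma vcross_axial_vectors:
  assumes "u \<in> axial_vectors" "v \<in> axial_vectors" shows "vcross u v \<in> axial_vectors"
proof -
  have "hat (vcross u v) = hat u * hat v - hat v * hat u"
    by (cases u; cases v) (simp add: algebra_simps)
  then show ?thesis
    using assms by (simp add: axial_vectors_def mat_alg_diff mat_alg_mult)
qed

lemma dot3_P:
  assumes "u \<in> axial_vectors" "v \<in> axial_vectors" shows "dot3 u v \<in> P"
proof -
  have "dot3 u v + dot3 u v = - tr3 (hat u * hat v)"
    by (cases u; cases v) (simp add: algebra_simps)
  then have "dot3 u v = hf * (- tr3 (hat u * hat v))"
    by (metis half_cancel)
  then show ?thesis
    using assms by (simp only: axial_vectors_def mem_Collect_eq P_half P_uminus tr_mat_alg mat_alg_mult)
qed

lemma triple_P: "u \<in> axial_vectors \<Longrightarrow> v \<in> axial_vectors \<Longrightarrow> w \<in> axial_vectors \<Longrightarrow> triple u v w \<in> P"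
  by (simp add: triple_def dot3_P vcross_axial_vectors)

lemma triple_cyclic: "triple u v w = triple v w u"
  unfolding triple_def by (cases u; cases v; cases w) (simp add: algebra_simps)

text \<open>
  Lagrange's identity: a triple product whose first entry is itself a cross product is a difference of
  products of scalar products.
\<close>

lemma triple_vcross_D:
  "p \<in> axial_vectors \<Longrightarrow> y \<in> axial_vectors \<Longrightarrow> v \<in> axial_vectors \<Longrightarrow> w \<in> axial_vectors \<Longrightarrow> triple (vcross p y) v w \<in> Dc"
  unfolding triple_vcross by (intro D_diff D_prod dot3_P)

text \<open>
  The identity matrix stands for the empty word, which \<^const>\<open>mat_alg\<close> leaves out.
\<close>

definition unital_alg :: "'r mat3 set" where "unital_alg = insert 1 mat_alg"

lemma unital_alg_mult: "A \<in> unital_alg \<Longrightarrow> B \<in> unital_alg \<Longrightarrow> A * B \<in> unital_alg"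
  by (auto simp: unital_alg_def mat_alg_mult)

lemma unital_alg_transp: "A \<in> unital_alg \<Longrightarrow> transp3 A \<in> unital_alg"
  by (auto simp: unital_alg_def mat_alg_transp)

lemma app3_one: "app3 1 v = v"
  by (cases v) (simp add: one_mat3_def)

lemma app3_unital_alg: "A \<in> unital_alg \<Longrightarrow> v \<in> axial_vectors \<Longrightarrow> app3 A v \<in> axial_vectors"
  by (auto simp: unital_alg_def app3_one app3_axial_vectors)

lemma triple_app3_vcross_D:
  assumes "A \<in> unital_alg" "p \<in> axial_vectors" "y \<in> axial_vectors" "v \<in> axial_vectors" "w \<in> axial_vectors"
  shows "triple (app3 A (vcross p y)) v w \<in> Dc"
proof (cases "A = 1")
  case True then show ?thesis using assms by (simp add: app3_one triple_vcross_D)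
next
  case False
  then have A: "A \<in> mat_alg" using assms by (simp add: unital_alg_def)
  have "triple (app3 A (vcross p y)) v w = tr3 A * triple (vcross p y) v w
      - triple (vcross p y) (app3 A v) w - triple (vcross p y) v (app3 A w)"
    using triple_derivation[of A "vcross p y" v w] by (simp add: algebra_simps)
  also have "\<dots> \<in> Dc"
    using A assms by (intro D_diff D_prod triple_vcross_D tr_mat_alg triple_P vcross_axial_vectors app3_axial_vectors)
  finally show ?thesis .
qed

text \<open>
  Twice the symmetric part of a letter, and the axis of twice its skew-symmetric part.
\<close>

definition sym_letter :: "'d \<Rightarrow> 'r mat3" where "sym_letter k = X k + transp3 (X k)"
definition skew_axis :: "'d \<Rightarrow> 'r vec3" where "skew_axis k = axial (X k)"
definition sym_word :: "'d list \<Rightarrow> 'r mat3" where "sym_word \<alpha> = prod_list (map sym_letter \<alpha>)"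

lemma sym_word_simps [simp]:
  "sym_word [] = 1" "sym_word (k # \<alpha>) = sym_letter k * sym_word \<alpha>" "sym_word (\<alpha> @ \<beta>) = sym_word \<alpha> * sym_word \<beta>"
  by (simp_all add: sym_word_def)

lemma X_mat_alg: "X k \<in> mat_alg"
  using letter_mat_alg[of "(True, k)"] by simp

lemma sym_letter_mat_alg: "sym_letter k \<in> mat_alg"
  by (simp add: sym_letter_def mat_alg_add mat_alg_transp X_mat_alg)

lemma skew_axis_axial_vectors: "skew_axis k \<in> axial_vectors"
  by (simp add: skew_axis_def axial_axial_vectors X_mat_alg)

lemma transp3_sym_letter: "transp3 (sym_letter k) = sym_letter k"
  by (simp add: sym_letter_def add.commute)

lemma sym_word_unital_alg: "sym_word \<alpha> \<in> unital_alg"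
  by (induction \<alpha>) (auto simp: unital_alg_def mat_alg_mult sym_letter_mat_alg)

lemma transp3_sym_word: "transp3 (sym_word \<alpha>) = sym_word (rev \<alpha>)"
  by (induction \<alpha>) (simp_all add: transp3_sym_letter)

text \<open>
  A commutator of two symmetric matrices is skew-symmetric; this is its axis.
\<close>

definition comm_axis :: "'d \<Rightarrow> 'd \<Rightarrow> 'r vec3" where
  "comm_axis i j = axial (sym_letter i * sym_letter j)"

lemma comm_axis_axial_vectors: "comm_axis i j \<in> axial_vectors"
  by (simp add: comm_axis_def axial_axial_vectors mat_alg_mult sym_letter_mat_alg)

lemma sym_word_swap:
  "sym_word (\<alpha> @ i # j # \<beta>) - sym_word (\<alpha> @ j # i # \<beta>) = sym_word \<alpha> * hat (comm_axis i j) * sym_word \<beta>"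
  by (simp add: comm_axis_def hat_axial transp3_sym_letter algebra_simps)

lemma sym_word_cube:
  "sym_word (k # k # k # \<beta>) = smul (tr3 (sym_letter k)) (sym_word (k # k # \<beta>)) - smul (minors3 (sym_letter k)) (sym_word (k # \<beta>))
    + smul (det3 (sym_letter k)) (sym_word \<beta>)"
proof -
  have "sym_word (k # k # k # \<beta>) = sym_letter k * sym_letter k * sym_letter k * sym_word \<beta>" by (simp add: mult.assoc)
  then show ?thesis unfolding cayley_hamilton3
    by (simp add: algebra_simps smul_simps)
qed

lemma app3_simps:
  "app3 (A + B) v = app3 A v + app3 B v" "app3 (A - B) v = app3 A v - app3 B v"
  by (cases A; cases B; cases v; simp add: algebra_simps)+

fun vscale :: "'r \<Rightarrow> 'r vec3 \<Rightarrow> 'r vec3" where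
  "vscale r (Vec3 x y z) = Vec3 (r * x) (r * y) (r * z)"

lemma app3_smul: "app3 (smul r A) v = vscale r (app3 A v)"
  by (cases A; cases v) (simp add: algebra_simps)

lemma triple_linear:
  "triple (u + u') v w = triple u v w + triple u' v w" "triple (u - u') v w = triple u v w - triple u' v w"
  "triple (vscale r u) v w = r * triple u v w"
  unfolding triple_def by (cases u; cases u'; cases v; cases w; simp add: algebra_simps)+

lemma dot3_linear:
  "dot3 u (v + v') = dot3 u v + dot3 u v'" "dot3 u (v - v') = dot3 u v - dot3 u v'" "dot3 u (vscale r v) = r * dot3 u v"
  "dot3 (v + v') u = dot3 v u + dot3 v' u" "dot3 (v - v') u = dot3 v u - dot3 v' u" "dot3 (vscale r v) u = r * dot3 v u"
  by (cases u; cases v; cases v'; simp add: algebra_simps)+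

text \<open>
  The symmetric letters act on the three entries of a triple product like variables in three slots. They
  commute, because a commutator turns an entry into a cross product. The relations between the slots
  hold because the sum of the actions of a matrix on the three entries multiplies a triple product by
  the trace of the matrix.
\<close>

lemma triple_sym_words_D:
  assumes "u \<in> axial_vectors" "v \<in> axial_vectors" "w \<in> axial_vectors" and long: "length \<alpha> + length \<beta> + length \<gamma> \<ge> 2 * CARD('d) + 2"
  shows "triple (app3 (sym_word \<alpha>) u) (app3 (sym_word \<beta>) v) (app3 (sym_word \<gamma>) w) \<in> Dc"
proof -
  let ?f = "\<lambda>u v w \<alpha> \<beta> \<gamma>. triple (app3 (sym_word \<alpha>) u) (app3 (sym_word \<beta>) v) (app3 (sym_word \<gamma>) w)"
  have V: "app3 (sym_word \<alpha>) v \<in> axial_vectors" if "v \<in> axial_vectors" for \<alpha> v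
    using that by (intro app3_unital_alg sym_word_unital_alg)
  have sw: "?f u v w (ys @ i # j # zs) \<beta> \<gamma> - ?f u v w (ys @ j # i # zs) \<beta> \<gamma> \<in> Dc"
    if "u \<in> axial_vectors" "v \<in> axial_vectors" "w \<in> axial_vectors" for u v w ys i j zs \<beta> \<gamma>
  proof -
    have "?f u v w (ys @ i # j # zs) \<beta> \<gamma> - ?f u v w (ys @ j # i # zs) \<beta> \<gamma>
      = triple (app3 (sym_word ys) (vcross (comm_axis i j) (app3 (sym_word zs) u))) (app3 (sym_word \<beta>) v) (app3 (sym_word \<gamma>) w)"
      by (simp only: triple_linear(2)[symmetric] app3_simps(2)[symmetric] sym_word_swap app3_mult app3_hat)
    then show ?thesis
      using that by (simp only: triple_app3_vcross_D sym_word_unital_alg comm_axis_axial_vectors V)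
  qed
  show ?thesis
  proof (rule three_slots_vanish[where D = Dc and f = "?f u v w"])
    fix ys zs \<beta> \<gamma> :: "'d list" and i j
    show "?f u v w (ys @ i # j # zs) \<beta> \<gamma> - ?f u v w (ys @ j # i # zs) \<beta> \<gamma> \<in> Dc"
      using assms by (intro sw)
  next
    fix zs \<alpha> \<gamma> :: "'d list" and i j
    show "?f u v w \<alpha> (i # j # zs) \<gamma> - ?f u v w \<alpha> (j # i # zs) \<gamma> \<in> Dc"
      using sw[of v w u "[]" i j zs \<gamma> \<alpha>] assms
      by (simp only: triple_cyclic[of "app3 (sym_word \<alpha>) u"] append_Nil)
  next
    fix k and zs \<beta> \<gamma> :: "'d list"
    show "?f u v w (k # k # k # zs) \<beta> \<gamma> \<in> Dc"
      unfolding sym_word_cube app3_simps app3_smul triple_linear using assms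
      by (intro D_add D_diff D_prod triple_P V tr_mat_alg minors_mat_alg det_mat_alg sym_letter_mat_alg)
  next
    fix k and \<alpha> \<beta> \<gamma> :: "'d list"
    show "?f u v w (k # \<alpha>) \<beta> \<gamma> + ?f u v w \<alpha> (k # \<beta>) \<gamma> + ?f u v w \<alpha> \<beta> (k # \<gamma>) \<in> Dc"
      unfolding sym_word_simps app3_mult triple_derivation using assms
      by (intro D_prod triple_P V tr_mat_alg sym_letter_mat_alg)
  next
    fix k l and \<alpha> \<beta> \<gamma> :: "'d list"
    show "?f u v w (k # l # \<alpha>) \<beta> \<gamma> + ?f u v w \<alpha> (k # l # \<beta>) \<gamma> + ?f u v w \<alpha> \<beta> (k # l # \<gamma>) \<in> Dc"
      unfolding sym_word_simps mult.assoc[symmetric] app3_mult[of "sym_letter k * sym_letter l"] triple_derivation using assms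
      by (intro D_prod triple_P V tr_mat_alg sym_letter_mat_alg mat_alg_mult)
  qed (use long in \<open>auto intro: D_zero D_add D_uminus D_twice\<close>)
qed

text \<open>
  Exchanging two letters in the word between two axes produces a third axis and thus a triple product
  with two letters less, which is decomposable by \<open>triple_sym_words_D\<close>. Hence the letters
  can be sorted until a cube appears.
\<close>

lemma dot_sym_word_D:
  assumes "p \<in> axial_vectors" "q \<in> axial_vectors" and long: "length \<alpha> \<ge> 2 * CARD('d) + 4"
  shows "dot3 p (app3 (sym_word \<alpha>) q) \<in> Dc"
proof (rule long_words_vanish[where D = Dc and g = "\<lambda>\<alpha>. dot3 p (app3 (sym_word \<alpha>) q)" and xs = \<alpha>])
  fix ys zs and i j :: 'd assume "length (ys @ i # j # zs) = length \<alpha>"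
  then have len: "length (rev ys) + length ([] :: 'd list) + length zs \<ge> 2 * CARD('d) + 2"
    using long by simp
  have "dot3 p (app3 (sym_word (ys @ i # j # zs)) q) - dot3 p (app3 (sym_word (ys @ j # i # zs)) q)
    = dot3 p (app3 (sym_word ys) (vcross (comm_axis i j) (app3 (sym_word zs) q)))"
    by (simp only: dot3_linear(2)[symmetric] app3_simps(2)[symmetric] sym_word_swap app3_mult app3_hat)
  also have "\<dots> = triple (app3 (sym_word (rev ys)) p) (app3 (sym_word []) (comm_axis i j)) (app3 (sym_word zs) q)"
    by (simp add: dot3_app3[of p] transp3_sym_word triple_def app3_one)
  also have "\<dots> \<in> Dc"
    using assms len by (intro triple_sym_words_D comm_axis_axial_vectors)
  finally show "dot3 p (app3 (sym_word (ys @ i # j # zs)) q) - dot3 p (app3 (sym_word (ys @ j # i # zs)) q) \<in> Dc" .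
next
  fix k zs
  show "dot3 p (app3 (sym_word (k # k # k # zs)) q) \<in> Dc"
    unfolding sym_word_cube app3_simps app3_smul dot3_linear using assms
    by (intro D_add D_diff D_prod dot3_P app3_unital_alg sym_word_unital_alg tr_mat_alg minors_mat_alg det_mat_alg sym_letter_mat_alg)
qed (use long in \<open>auto intro: D_zero D_add\<close>)

section \<open>Long traces in characteristic three\<close>

context
  assumes three: "(3 :: 'r) = 0"
begin

text \<open>
  The identity matrix has trace \<open>3 = 0\<close>.
\<close>

lemma tr_unital_alg: "A \<in> unital_alg \<Longrightarrow> tr3 A \<in> P"
  by (auto simp: unital_alg_def tr_mat_alg three P_zero)

lemma tr_hat_hat: "tr3 (hat p * hat q * N) = dot3 p (app3 N q) - dot3 p q * tr3 N"
  by (simp add: hat_hat algebra_simps smul_simps tr3_outer)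

text \<open>
  Moving \<open>A\<close> past the first skew-symmetric factor brings the two such factors together.
  Their product has rank one apart from a scalar, so that the trace turns into scalar products.
\<close>

lemma tr_two_hats:
  assumes "p \<in> axial_vectors" "q \<in> axial_vectors" "A \<in> unital_alg" "M \<in> unital_alg"
  shows "tr3 (hat p * A * hat q * M) + dot3 (app3 A p) (app3 M q) + dot3 p (app3 (M * transp3 A) q) \<in> Dc"
proof -
  have "hat p * A * hat q * M
    = smul (tr3 A) (hat p * hat q * M) - hat (app3 A p) * hat q * M - transp3 A * (hat p * hat q * M)"
    unfolding hat_mult[of p A] by (simp add: algebra_simps smul_simps)
  then have "tr3 (hat p * A * hat q * M)
    = tr3 A * tr3 (hat p * hat q * M) - tr3 (hat (app3 A p) * hat q * M) - tr3 (hat p * hat q * (M * transp3 A))"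
    by (simp add: tr3_mult_commute[of "transp3 A"] mult.assoc)
  then have "tr3 (hat p * A * hat q * M) + dot3 (app3 A p) (app3 M q) + dot3 p (app3 (M * transp3 A) q)
    = tr3 A * (dot3 p (app3 M q) - dot3 p q * tr3 M) + dot3 (app3 A p) q * tr3 M + dot3 p q * tr3 (M * transp3 A)"
    unfolding tr_hat_hat by (simp add: algebra_simps)
  also have "\<dots> \<in> Dc"
    using assms by (intro D_add D_prod P_diff P_mult tr_unital_alg dot3_P app3_unital_alg unital_alg_mult unital_alg_transp)
  finally show ?thesis .
qed

lemma D_two_hats:
  assumes "p \<in> axial_vectors" "q \<in> axial_vectors" "A \<in> unital_alg" "M \<in> unital_alg"
    and "dot3 (app3 A p) (app3 M q) \<in> Dc" "dot3 p (app3 (M * transp3 A) q) \<in> Dc"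
  shows "tr3 (hat p * A * hat q * M) \<in> Dc"
  using D_diff[OF D_diff[OF tr_two_hats[OF assms(1-4)] assms(6)] assms(5)] by simp

lemma tr_two_skews_D:
  assumes "p \<in> axial_vectors" "q \<in> axial_vectors" and long: "length \<alpha> + length \<beta> \<ge> 2 * CARD('d) + 4"
  shows "tr3 (hat p * sym_word \<alpha> * hat q * sym_word \<beta>) \<in> Dc"
proof (rule D_two_hats[OF assms(1,2) sym_word_unital_alg sym_word_unital_alg])
  show "dot3 (app3 (sym_word \<alpha>) p) (app3 (sym_word \<beta>) q) \<in> Dc"
    using dot_sym_word_D[of p q "rev \<alpha> @ \<beta>"] assms
    by (simp add: app3_mult dot3_app3[of p] transp3_sym_word)
  show "dot3 p (app3 (sym_word \<beta> * transp3 (sym_word \<alpha>)) q) \<in> Dc"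
    using dot_sym_word_D[of p q "\<beta> @ rev \<alpha>"] assms by (simp add: transp3_sym_word)
qed

text \<open>
  Transposition shows that reversing the word changes the sign of the trace. Reversing it by exchanges
  of adjacent letters changes the trace only by traces with a second skew-symmetric factor.
\<close>

lemma tr_one_skew_D:
  assumes "p \<in> axial_vectors" and long: "length \<alpha> \<ge> 2 * CARD('d) + 6"
  shows "tr3 (hat p * sym_word \<alpha>) \<in> Dc"
proof (rule D_twice)
  let ?g = "\<lambda>\<alpha>. tr3 (hat p * sym_word \<alpha>)"
  have sw: "?g (ys @ i # j # zs) - ?g (ys @ j # i # zs) \<in> Dc" if "length (ys @ i # j # zs) = length \<alpha>" for ys i j zs
  proof -
    have "?g (ys @ i # j # zs) - ?g (ys @ j # i # zs) = tr3 (hat p * sym_word ys * hat (comm_axis i j) * sym_word zs)"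
      by (simp only: tr3_simps(2)[symmetric] right_diff_distrib[symmetric] sym_word_swap mult.assoc)
    also have "\<dots> \<in> Dc"
      using assms that by (intro tr_two_skews_D comm_axis_axial_vectors) simp_all
    finally show ?thesis .
  qed
  have "?g ([] @ \<alpha>) - ?g ([] @ rev \<alpha>) \<in> Dc"
    by (rule mset_eq_congruent[where D = Dc and g = ?g and n = "length \<alpha>"]) (use D_zero D_add sw in auto)
  moreover have "?g (rev \<alpha>) = - ?g \<alpha>"
  proof -
    have "transp3 (hat p) = - hat p" by (cases p) simp
    then show ?thesis
      using tr3_simps(7)[of "hat p * sym_word (rev \<alpha>)"]
      by (simp add: transp3_sym_word tr3_mult_commute[of "sym_word \<alpha>"])
  qed
  ultimately show "?g \<alpha> + ?g \<alpha> \<in> Dc" by simp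
qed

lemma tr_no_skew_D:
  assumes long: "length \<alpha> \<ge> 2 * CARD('d) + 8"
  shows "tr3 (sym_word \<alpha>) \<in> Dc"
proof (rule long_words_vanish[where D = Dc and g = "\<lambda>\<alpha>. tr3 (sym_word \<alpha>)" and xs = \<alpha>])
  fix ys zs and i j :: 'd assume len: "length (ys @ i # j # zs) = length \<alpha>"
  have "tr3 (sym_word (ys @ i # j # zs)) - tr3 (sym_word (ys @ j # i # zs)) = tr3 (hat (comm_axis i j) * sym_word (zs @ ys))"
    unfolding tr3_simps(2)[symmetric] sym_word_swap
    using tr3_mult_commute[of "sym_word ys"] by (simp add: mult.assoc)
  also have "\<dots> \<in> Dc"
    using len long by (intro tr_one_skew_D comm_axis_axial_vectors) simp_all
  finally show "tr3 (sym_word (ys @ i # j # zs)) - tr3 (sym_word (ys @ j # i # zs)) \<in> Dc" .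
next
  fix k zs
  show "tr3 (sym_word (k # k # k # zs)) \<in> Dc"
    unfolding sym_word_cube tr3_simps
    by (intro D_add D_diff D_prod tr_unital_alg sym_word_unital_alg tr_mat_alg minors_mat_alg det_mat_alg sym_letter_mat_alg)
qed (use long in \<open>auto intro: D_zero D_add\<close>)

lemma dot3_app3_hat:
  "dot3 x (app3 (B * hat r * C) y) = triple (app3 (transp3 B) x) r (app3 C y)"
  by (simp add: app3_mult dot3_app3[of x] app3_hat triple_def)

text \<open>
  Both scalar products that come from two of the skew-symmetric factors are triple products with the
  third axis.
\<close>

lemma tr_three_skews_D:
  assumes "p \<in> axial_vectors" "q \<in> axial_vectors" "r \<in> axial_vectors" and long: "length \<alpha> + length \<beta> + length \<gamma> \<ge> 2 * CARD('d) + 2"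
  shows "tr3 (hat p * sym_word \<alpha> * hat q * (sym_word \<beta> * hat r * sym_word \<gamma>)) \<in> Dc"
proof (rule D_two_hats[OF assms(1,2) sym_word_unital_alg])
  have "hat r \<in> unital_alg" using assms by (simp add: axial_vectors_def unital_alg_def)
  then show "sym_word \<beta> * hat r * sym_word \<gamma> \<in> unital_alg"
    by (intro unital_alg_mult sym_word_unital_alg)
  have "triple (app3 (sym_word (rev \<beta> @ \<alpha>)) p) (app3 (sym_word []) r) (app3 (sym_word \<gamma>) q) \<in> Dc"
    using assms by (intro triple_sym_words_D) simp_all
  then show "dot3 (app3 (sym_word \<alpha>) p) (app3 (sym_word \<beta> * hat r * sym_word \<gamma>) q) \<in> Dc"
    unfolding dot3_app3_hat by (simp add: app3_one app3_mult transp3_sym_word)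
  have "triple (app3 (sym_word (rev \<beta>)) p) (app3 (sym_word []) r) (app3 (sym_word (\<gamma> @ rev \<alpha>)) q) \<in> Dc"
    using assms by (intro triple_sym_words_D) simp_all
  then show "dot3 p (app3 (sym_word \<beta> * hat r * sym_word \<gamma> * transp3 (sym_word \<alpha>)) q) \<in> Dc"
    unfolding mult.assoc[of _ "sym_word \<gamma>"] dot3_app3_hat by (simp add: app3_one transp3_sym_word)
qed

text \<open>
  The remaining two skew-symmetric factors produce a triple product with a nested cross product.
\<close>

lemma tr_four_skews_D:
  assumes "p \<in> axial_vectors" "q \<in> axial_vectors" "r \<in> axial_vectors" "s \<in> axial_vectors" "A \<in> unital_alg" "B \<in> unital_alg" "C \<in> unital_alg" "D \<in> unital_alg"
  shows "tr3 (hat p * A * hat q * (B * hat r * (C * hat s * D))) \<in> Dc"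
proof (rule D_two_hats[OF assms(1,2,5)])
  have hats: "hat r \<in> unital_alg" "hat s \<in> unital_alg" using assms by (simp_all add: axial_vectors_def unital_alg_def)
  then show "B * hat r * (C * hat s * D) \<in> unital_alg"
    using assms by (intro unital_alg_mult)
  have *: "dot3 x (app3 (B * hat r * (C * hat s * D')) y) \<in> Dc" if "x \<in> axial_vectors" "y \<in> axial_vectors" "D' \<in> unital_alg" for x y D'
  proof -
    have "dot3 x (app3 (B * hat r * (C * hat s * D')) y)
      = triple (app3 C (vcross s (app3 D' y))) (app3 (transp3 B) x) r"
      unfolding dot3_app3_hat by (simp add: app3_mult app3_hat triple_cyclic[of "app3 C _"])
    also have "\<dots> \<in> Dc"
      using assms that by (intro triple_app3_vcross_D app3_unital_alg unital_alg_transp)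
    finally show ?thesis .
  qed
  show "dot3 (app3 A p) (app3 (B * hat r * (C * hat s * D)) q) \<in> Dc"
    using assms by (intro * app3_unital_alg)
  show "dot3 p (app3 (B * hat r * (C * hat s * D) * transp3 A) q) \<in> Dc"
    using assms *[of p q "D * transp3 A"] by (simp only: mult.assoc unital_alg_mult unital_alg_transp)
qed

text \<open>
  The same alphabet, now with the flag distinguishing the symmetric and the skew-symmetric part of a
  letter.
\<close>

fun split_letter :: "bool \<times> 'd \<Rightarrow> 'r mat3" where
  "split_letter (b, k) = (if b then sym_letter k else hat (skew_axis k))"

definition split_word :: "(bool \<times> 'd) list \<Rightarrow> 'r mat3" where
  "split_word xs = prod_list (map split_letter xs)"

lemma split_word_simps [simp]:
  "split_word [] = 1" "split_word (x # xs) = split_letter x * split_word xs" "split_word (xs @ ys) = split_word xs * split_word ys"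
  "split_word (map (Pair True) \<alpha>) = sym_word \<alpha>"
  by (simp_all add: split_word_def sym_word_def o_def)

lemma split_word_unital_alg: "split_word xs \<in> unital_alg"
proof (induction xs)
  case (Cons x xs)
  have "split_letter x \<in> unital_alg"
    using skew_axis_axial_vectors[of "snd x"] by (cases x) (simp add: unital_alg_def sym_letter_mat_alg axial_vectors_def)
  with Cons show ?case by (simp add: unital_alg_mult)
qed (simp add: unital_alg_def)

lemma first_skew:
  obtains \<alpha> where "xs = map (Pair True) \<alpha>"
  | \<alpha> k ys where "xs = map (Pair True) \<alpha> @ (False, k) # ys"
proof (induction xs arbitrary: thesis)
  case Nil then show ?case by (metis list.map_disc_iff)
next
  case (Cons x xs)
  obtain b k where x: "x = (b, k)" by force
  show ?case
  proof (cases b)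
    case False
    then show ?thesis using Cons.prems(2)[of "[]" k xs] by (simp add: x)
  next
    case True
    show ?thesis
    proof (rule Cons.IH)
      fix \<alpha> assume "xs = map (Pair True) \<alpha>"
      then show ?thesis using Cons.prems(1)[of "k # \<alpha>"] True by (simp add: x)
    next
      fix \<alpha> k' ys assume "xs = map (Pair True) \<alpha> @ (False, k') # ys"
      then show ?thesis using Cons.prems(2)[of "k # \<alpha>" k' ys] True by (simp add: x)
    qed
  qed
qed

text \<open>
  The number of skew-symmetric letters decides. If there are four, the trace is decomposable regardless
  of its length. Otherwise each loss of length that is caused by exchanging two symmetric letters is
  accompanied by a new skew-symmetric factor, so that at most three axes occur, each of which uses up at
  most two letters: the three slots receive at least \<open>2 n + 8 - 6\<close> letters.
\<close>

lemma tr_split_word_D: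
  assumes long: "length xs \<ge> 2 * CARD('d) + 8"
  shows "tr3 (split_word xs) \<in> Dc"
proof (cases xs rule: first_skew)
  case (1 \<alpha>)
  then show ?thesis using long by (simp add: tr_no_skew_D)
next
  case xs: (2 \<alpha> k ys)
  let ?p = "skew_axis k"
  have rot: "tr3 (split_word xs) = tr3 (hat ?p * split_word (ys @ map (Pair True) \<alpha>))"
    using tr3_mult_commute[of "sym_word \<alpha>"] by (simp add: xs mult.assoc)
  show ?thesis
  proof (cases ys rule: first_skew)
    case (1 \<beta>)
    then show ?thesis unfolding rot
      using long tr_one_skew_D[OF skew_axis_axial_vectors, of "\<beta> @ \<alpha>" k] by (simp add: xs)
  next
    case ys: (2 \<beta> l zs)
    show ?thesis
    proof (cases zs rule: first_skew)
      case (1 \<gamma>)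
      then show ?thesis unfolding rot
        using long tr_two_skews_D[OF skew_axis_axial_vectors skew_axis_axial_vectors, of \<beta> "\<gamma> @ \<alpha>" k l] by (simp add: xs ys mult.assoc)
    next
      case zs: (2 \<gamma> m us)
      show ?thesis
      proof (cases us rule: first_skew)
        case (1 \<delta>)
        then show ?thesis unfolding rot
          using long tr_three_skews_D[OF skew_axis_axial_vectors skew_axis_axial_vectors skew_axis_axial_vectors, of \<beta> \<gamma> "\<delta> @ \<alpha>" k l m]
          by (simp add: xs ys zs mult.assoc)
      next
        case us: (2 \<delta> n vs)
        show ?thesis unfolding rot
          using tr_four_skews_D[OF skew_axis_axial_vectors skew_axis_axial_vectors skew_axis_axial_vectors skew_axis_axial_vectors sym_word_unital_alg sym_word_unital_alg sym_word_unital_alg split_word_unital_alg,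
              of k \<beta> l \<gamma> m \<delta> n "vs @ map (Pair True) \<alpha>"]
          by (simp add: ys zs us mult.assoc)
      qed
    qed
  qed
qed

lemma letter_twice: "letter X (b, k) + letter X (b, k) = split_letter (True, k) + (if b then split_letter (False, k) else - split_letter (False, k))"
  by (simp add: sym_letter_def skew_axis_def hat_axial algebra_simps)

text \<open>
  Twice a letter is the sum or the difference of the two split letters with the same index; the letters
  are replaced one by one.
\<close>

lemma tr_mixed_word_D:
  assumes "length xs + length ys \<ge> 2 * CARD('d) + 8"
  shows "tr3 (split_word xs * word X ys) \<in> Dc"
  using assms
proof (induction ys arbitrary: xs)
  case Nil then show ?case by (simp add: tr_split_word_D)
next
  case (Cons y ys)
  obtain b k where y: "y = (b, k)" by force
  have IH: "tr3 (split_word (xs @ [z]) * word X ys) \<in> Dc" for z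
    using Cons.prems by (intro Cons.IH) simp
  have "tr3 (split_word xs * word X (y # ys)) + tr3 (split_word xs * word X (y # ys))
    = tr3 (split_word xs * (letter X (b, k) + letter X (b, k)) * word X ys)"
    by (simp only: y word_simps tr3_simps distrib_left distrib_right mult.assoc)
  also have "\<dots> = tr3 (split_word (xs @ [(True, k)]) * word X ys)
      + (if b then tr3 (split_word (xs @ [(False, k)]) * word X ys) else - tr3 (split_word (xs @ [(False, k)]) * word X ys))"
    unfolding letter_twice by (simp del: split_letter.simps add: algebra_simps)
  also have "\<dots> \<in> Dc"
    using IH by (simp del: split_word_simps add: D_add D_uminus)
  finally show ?case by (rule D_twice)
qed

theorem tr_long_word_char_3:
  assumes "length xs \<ge> 2 * CARD('d) + 8"
  shows "tr3 (word X xs) \<in> Dc"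
  using tr_mixed_word_D[of "[]" xs] assms by simp

end

end

section \<open>The generators of the algebra of invariants\<close>

definition to_mat3 :: "'r^3^3 \<Rightarrow> 'r mat3" where
  "to_mat3 A = (let a = (\<lambda>i j. vec_nth (vec_nth A i) j) in
     Mat3 (a 1 1) (a 1 2) (a 1 3) (a 2 1) (a 2 2) (a 2 3) (a 3 1) (a 3 2) (a 3 3))"

lemma to_mat3_mult: "to_mat3 (A ** B) = to_mat3 A * to_mat3 (B :: 'r::comm_ring_1^3^3)"
  by (simp add: to_mat3_def Let_def matrix_matrix_mult_def sum_3)

lemma to_mat3_transpose: "to_mat3 (transpose A) = transp3 (to_mat3 (A :: 'r::comm_ring_1^3^3))"
  by (simp add: to_mat3_def Let_def transpose_def)

definition invariant3 :: "nat \<Rightarrow> 'r::comm_ring_1 mat3 \<Rightarrow> 'r" where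
  "invariant3 t M = (if t = 1 then tr3 M else if t = 2 then minors3 M else det3 M)"

lemma invariant3_simps [simp]:
  "invariant3 1 M = tr3 M" "invariant3 (Suc 0) M = tr3 M" "invariant3 2 M = minors3 M" "invariant3 3 M = det3 M"
  by (simp_all add: invariant3_def)

lemma sigma_invariant3:
  assumes "t \<in> {1..3}" shows "sigma t A = invariant3 t (to_mat3 (A :: 'r::comm_ring_1^3^3))"
proof -
  have t: "t = 1 \<or> t = 2 \<or> t = 3" using assms by auto
  have cp: "char_polynomial A =
     [:- det3 (to_mat3 A), minors3 (to_mat3 A), - tr3 (to_mat3 A), 1:]"
    by (simp add: char_polynomial_def det_3 to_mat3_def Let_def mat_def map_matrix_def algebra_simps)
  show ?thesis
    using t unfolding sigma_def cp
    by (elim disjE) (simp_all add: eval_nat_numeral invariant3_def)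
qed

definition generic_mat3 :: "'d \<Rightarrow> ('a::comm_ring_1, 'd) matrix_poly mat3" where
  "generic_mat3 k = to_mat3 (generic_matrix k)"

lemma matrix_monomial_word:
  assumes "A \<in> matrix_monomials" shows "\<exists>xs. xs \<noteq> [] \<and> to_mat3 A = word generic_mat3 xs"
  using assms
proof induction
  case (generic k)
  show ?case by (rule exI[of _ "[(True, k)]"]) (simp add: generic_mat3_def)
next
  case (transposed k)
  show ?case by (rule exI[of _ "[(False, k)]"]) (simp add: generic_mat3_def to_mat3_transpose)
next
  case (product A B)
  then obtain xs ys where "xs \<noteq> []" "to_mat3 A = word generic_mat3 xs" "to_mat3 B = word generic_mat3 ys" by blast
  then show ?case by (intro exI[of _ "xs @ ys"]) (simp add: to_mat3_mult)
qed

lemma letter_matrix_monomial: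
  "\<exists>A\<in>matrix_monomials. to_mat3 A = letter (generic_mat3 :: 'd \<Rightarrow> ('a::comm_ring_1, 'd) matrix_poly mat3) x"
proof (cases x)
  case (Pair b k)
  let ?A = "if b then generic_matrix k else transpose (generic_matrix k)"
  have "?A \<in> matrix_monomials"
    by (simp add: matrix_monomials.generic matrix_monomials.transposed)
  moreover have "to_mat3 ?A = letter generic_mat3 x"
    by (simp add: Pair generic_mat3_def to_mat3_transpose)
  ultimately show ?thesis by blast
qed

lemma word_matrix_monomial:
  "xs \<noteq> [] \<Longrightarrow> \<exists>A\<in>matrix_monomials. to_mat3 A = word (generic_mat3 :: 'd \<Rightarrow> ('a::comm_ring_1, 'd) matrix_poly mat3) xs"
proof (induction xs rule: list_nonempty_induct)
  case (single x)
  show ?case using letter_matrix_monomial[of x] by simp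
next
  case (cons x xs)
  then obtain B :: "('a, 'd) matrix_poly^3^3" where B: "B \<in> matrix_monomials" "to_mat3 B = word generic_mat3 xs" by blast
  obtain C :: "('a, 'd) matrix_poly^3^3" where C: "C \<in> matrix_monomials" "to_mat3 C = letter generic_mat3 x"
    using letter_matrix_monomial[of x] by blast
  have "to_mat3 (C ** B) = word generic_mat3 (x # xs)" by (simp add: to_mat3_mult B C)
  then show ?case using matrix_monomials.product[OF C(1) B(1)] by blast
qed

definition invariant_generators :: "('a::field, 'd) matrix_poly set" where
  "invariant_generators = {invariant3 t (word generic_mat3 xs) | t xs. t \<in> {1..3} \<and> xs \<noteq> []}"

lemma O3_invariants_generated: "O3_invariants = generated_subalgebra (invariant_generators :: ('a::field, 'd::finite) matrix_poly set)"
proof -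
  have "{sigma t A | t A. t \<in> {1..3} \<and> A \<in> matrix_monomials} = (invariant_generators :: ('a, 'd) matrix_poly set)"
  proof (intro equalityI subsetI)
    fix f :: "('a, 'd) matrix_poly" assume "f \<in> {sigma t A | t A. t \<in> {1..3} \<and> A \<in> matrix_monomials}"
    then obtain t A where "f = sigma t A" "t \<in> {1..3}" "A \<in> matrix_monomials" by blast
    moreover from this(3) obtain xs where "xs \<noteq> []" "to_mat3 A = word generic_mat3 xs"
      using matrix_monomial_word by blast
    moreover from calculation have "f = invariant3 t (word generic_mat3 xs)"
      by (simp only: sigma_invariant3)
    ultimately show "f \<in> invariant_generators"
      unfolding invariant_generators_def by blast
  next
    fix f :: "('a, 'd) matrix_poly" assume "f \<in> invariant_generators"
    then obtain t xs where f: "f = invariant3 t (word generic_mat3 xs)" "t \<in> {1..3}" "xs \<noteq> []" unfolding invariant_generators_def by blast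
    obtain A :: "('a, 'd) matrix_poly^3^3" where A: "A \<in> matrix_monomials" "to_mat3 A = word generic_mat3 xs"
      using word_matrix_monomial[OF f(3)] by blast
    then have "f = sigma t A"
      by (simp only: f(1) sigma_invariant3[OF f(2)])
    then show "f \<in> {sigma t A | t A. t \<in> {1..3} \<and> A \<in> matrix_monomials}"
      using f(2) A(1) by blast
  qed
  then show ?thesis by (simp add: O3_invariants_def)
qed

definition hom_degree_mat3 :: "nat \<Rightarrow> ('v, 'a::comm_ring_1) mvpoly mat3 \<Rightarrow> bool" where
  "hom_degree_mat3 n M \<longleftrightarrow> (\<forall>e\<in>set_mat3 M. hom_degree n e)"

lemma hom_degree_mat3_mult:
  assumes "hom_degree_mat3 n A" "hom_degree_mat3 m B" shows "hom_degree_mat3 (n + m) (A * B)"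
  using assms by (cases A; cases B) (auto simp: hom_degree_mat3_def intro!: hom_degree_add hom_degree_mult)

lemma hom_degree_mat3_letter: "hom_degree_mat3 1 (letter generic_mat3 x :: ('a::comm_ring_1, 'd) matrix_poly mat3)"
proof -
  have "hom_degree 1 (pvar v :: ('v, 'a) mvpoly)" for v :: 'v
    by (auto simp: hom_degree_def pvar_def monomial_degree_def)
  then show ?thesis
    by (cases x) (auto simp: generic_mat3_def to_mat3_def Let_def hom_degree_mat3_def generic_matrix_def)
qed

lemma hom_degree_mat3_word: "hom_degree_mat3 (length xs) (word generic_mat3 xs :: ('a::comm_ring_1, 'd) matrix_poly mat3)"
proof (induction xs)
  case Nil then show ?case by (simp add: hom_degree_mat3_def one_mat3_def hom_degree_one)
next
  case (Cons x xs)
  then show ?case using hom_degree_mat3_mult[OF hom_degree_mat3_letter Cons] by simp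
qed

lemma hom_degree_mat3_invariants:
  assumes "hom_degree_mat3 n M"
  shows "hom_degree n (tr3 M)" "hom_degree (n + n) (minors3 M)" "hom_degree (n + (n + n)) (det3 M)"
  using assms by (cases M; auto simp: hom_degree_mat3_def intro!: hom_degree_add hom_degree_diff hom_degree_mult)+

lemma hom_degree_invariant3:
  assumes "hom_degree_mat3 n M" "t \<in> {1..3}" shows "hom_degree (t * n) (invariant3 t M)"
proof -
  have t: "t = 1 \<or> t = 2 \<or> t = 3" using assms by auto
  have e: "2 * n = n + n" "3 * n = n + (n + n)" by simp_all
  have "hom_degree (2 * n) (minors3 M)" "hom_degree (3 * n) (det3 M)"
    unfolding e using hom_degree_mat3_invariants[OF assms(1)] by simp_all
  then show ?thesis
    using t hom_degree_mat3_invariants(1)[OF assms(1)] by (elim disjE) simp_all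
qed

lemma invariant_generators_graded: "graded_generators invariant_generators (O3_invariants :: ('a::field, 'd::finite) matrix_poly set)"
proof
  fix g :: "('a, 'd) matrix_poly" assume "g \<in> invariant_generators"
  then show "homogeneous g"
    using hom_degree_homogeneous(1)[OF hom_degree_invariant3[OF hom_degree_mat3_word]] unfolding invariant_generators_def by blast
qed (rule O3_invariants_generated)

lemma invariant_generators_in_positive_part:
  assumes "g \<in> invariant_generators" shows "g \<in> positive_part (O3_invariants :: ('a::field, 'd::finite) matrix_poly set)"
proof -
  interpret graded_generators invariant_generators "O3_invariants :: ('a, 'd) matrix_poly set" by (rule invariant_generators_graded)
  obtain t xs where g: "g = invariant3 t (word generic_mat3 xs)" "t \<in> {1..3}" "xs \<noteq> []" using assms unfolding invariant_generators_def by blast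
  have hom: "hom_degree (t * length xs) g"
    unfolding g(1) by (rule hom_degree_invariant3[OF hom_degree_mat3_word g(2)])
  have "t * length xs > 0" using g by simp
  then show ?thesis
    using hom_degree_homogeneous[OF hom] assms G_A
    by (cases "g = 0") (auto simp: P_closed intro!: positive_part_incl)
qed

lemma two_invertible:
  assumes "CHAR('a::field) \<noteq> 2" shows "(2 :: 'a) \<noteq> 0"
proof
  assume "(2 :: 'a) = 0"
  then have "of_nat 2 = (0 :: 'a)" by simp
  then have "CHAR('a) dvd 2" by (simp only: of_nat_eq_0_iff_char_dvd)
  then have "CHAR('a) = 1 \<or> CHAR('a) = 2" using prime_nat_iff two_is_prime_nat by blast
  with assms show False using CHAR_not_1 by auto
qed

lemma three_invertible:
  assumes "CHAR('a::field) \<noteq> 3" shows "(3 :: 'a) \<noteq> 0"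
proof
  assume "(3 :: 'a) = 0"
  then have "of_nat 3 = (0 :: 'a)" by simp
  then have "CHAR('a) dvd 3" by (simp only: of_nat_eq_0_iff_char_dvd)
  moreover have "prime (3 :: nat)" by simp
  ultimately have "CHAR('a) = 1 \<or> CHAR('a) = 3" using prime_nat_iff by blast
  with assms show False using CHAR_not_1 by auto
qed

lemma numeral_mult_cst_inverse:
  assumes "(numeral w :: 'a::field) \<noteq> 0"
  shows "numeral w * cst (1 / numeral w) = (1 :: ('v, 'a) mvpoly)"
proof -
  have "numeral w * cst (1 / numeral w) = (cst (numeral w) * cst (1 / numeral w) :: ('v, 'a) mvpoly)"
    by (simp only: single_numeral)
  also have "\<dots> = cst (numeral w * (1 / numeral w))" by (simp only: mult_single add_0)
  also have "\<dots> = 1" using assms by simp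
  finally show ?thesis .
qed

lemma trace_ring_O3:
  assumes "CHAR('a::field) \<noteq> 2"
  shows "trace_ring (positive_part O3_invariants) (decomposables O3_invariants) (cst (1 / 2))
    (generic_mat3 :: 'd::finite \<Rightarrow> ('a, 'd) matrix_poly mat3)"
proof -
  interpret graded_generators invariant_generators "O3_invariants :: ('a, 'd) matrix_poly set" by (rule invariant_generators_graded)
  have scal: "cst c * p = pscale c p" for c and p :: "('a, 'd) matrix_poly" by (simp add: pscale_def)
  have neg: "- p = pscale (- 1) p" for p :: "('a, 'd) matrix_poly"
    by (simp add: pscale_def single_uminus)
  have g: "invariant3 t (word generic_mat3 xs) \<in> positive_part (O3_invariants :: ('a, 'd) matrix_poly set)"
    if "t \<in> {1..3}" "xs \<noteq> []" for t xs
    using that by (intro invariant_generators_in_positive_part) (auto simp: invariant_generators_def)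
  show ?thesis
  proof
    show "2 * cst (1 / 2) = (1 :: ('a, 'd) matrix_poly)"
      using numeral_mult_cst_inverse[OF two_invertible[OF assms]] .
  next
    fix xs :: "(bool \<times> 'd) list" assume "xs \<noteq> []"
    then show "tr3 (word generic_mat3 xs) \<in> positive_part (O3_invariants :: ('a, 'd) matrix_poly set)"
      using g[of 1 xs] by simp
  next
    fix k
    show "det3 (generic_mat3 k) \<in> positive_part (O3_invariants :: ('a, 'd) matrix_poly set)"
      using g[of 3 "[(True, k)]"] by simp
  qed (simp_all only: scal neg P_closed D_closed D_prod D_subset_P)
qed

text \<open>
  Only traces matter: \<open>2 \<sigma>\<^sub>2(w)\<close> is \<open>tr(w)\<^sup>2 -
  tr(w\<^sup>2)\<close>, where \<open>w\<^sup>2\<close> has the same degree as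
  \<open>\<sigma>\<^sub>2(w)\<close>, and determinants are multiplicative, so those of words with at
  least two letters are decomposable.
\<close>

lemma (in trace_ring) invariant3_long_word_D:
  assumes tr: "\<And>xs. length xs > N \<Longrightarrow> tr3 (word X xs) \<in> Dc" and N: "N \<ge> 3"
    and t: "t \<in> {1..3}" and long: "t * length xs > N"
  shows "invariant3 t (word X xs) \<in> Dc"
proof -
  have ne: "xs \<noteq> []" using long by auto
  have "t = 1 \<or> t = 2 \<or> t = 3" using t by auto
  then consider "t = 1" | "t = 2" | "t = 3" by blast
  then show ?thesis
  proof cases
    case 1 then show ?thesis using tr long by simp
  next
    case 2
    have "minors3 (word X xs) + minors3 (word X xs) = tr3 (word X xs) * tr3 (word X xs) - tr3 (word X (xs @ xs))"
      by (simp only: word_simps twice_minors3[symmetric] mult_2)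
    also have "\<dots> \<in> Dc"
      using 2 long ne by (intro D_diff D_prod tr tr_word) simp_all
    finally show ?thesis using D_twice 2 by simp
  next
    case 3
    then obtain y z zs where "xs = y # z # zs" using long N by (cases xs; cases "tl xs") auto
    then show ?thesis
      using 3 D_prod[OF det_X det_word[of "z # zs"]] by (simp add: det3_mult det3_letter)
  qed
qed

lemma upper_bound:
  assumes "CHAR('a::field) \<noteq> 2" and N: "if CHAR('a) = 3 then N = 2 * CARD('d) + 7 else N = 6"
    and "g \<in> invariant_generators" "total_degree g > N"
  shows "g \<in> decomposables (O3_invariants :: ('a, 'd::finite) matrix_poly set)"
proof -
  interpret trace_ring "positive_part O3_invariants" "decomposables O3_invariants" "cst (1 / 2)"
    "generic_mat3 :: 'd \<Rightarrow> ('a, 'd) matrix_poly mat3"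
    by (rule trace_ring_O3[OF assms(1)])
  obtain t xs where g: "g = invariant3 t (word generic_mat3 xs)" "t \<in> {1..3}" "xs \<noteq> []" using assms unfolding invariant_generators_def by blast
  have "hom_degree (t * length xs) g"
    unfolding g(1) by (rule hom_degree_invariant3[OF hom_degree_mat3_word g(2)])
  moreover have "g \<noteq> 0" using assms(4) by (auto simp: total_degree_def)
  ultimately have long: "t * length xs > N"
    using hom_degree_homogeneous(2) assms(4) by metis
  have tr: "tr3 (word generic_mat3 xs) \<in> decomposables (O3_invariants :: ('a, 'd) matrix_poly set)" if "length xs > N"
    for xs :: "(bool \<times> 'd) list"
  proof (cases "CHAR('a) = 3")
    case True
    then have "(3 :: 'a) = 0" using of_nat_CHAR[where 'a = 'a] by simp
    then have "(3 :: ('a, 'd) matrix_poly) = 0" by (simp only: single_numeral[symmetric] single_zero)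
    then show ?thesis using True N that by (intro tr_long_word_char_3) auto
  next
    case False
    interpret graded_generators invariant_generators "O3_invariants :: ('a, 'd) matrix_poly set" by (rule invariant_generators_graded)
    have "p \<in> decomposables O3_invariants" if "p + p + p \<in> decomposables O3_invariants"
      for p :: "('a, 'd) matrix_poly"
    proof -
      have "pscale (1 / 3) (p + p + p) = (3 * cst (1 / 3)) * p"
        by (simp add: pscale_def algebra_simps)
      also have "\<dots> = p"
        by (simp only: numeral_mult_cst_inverse[OF three_invertible[OF False]] mult_1)
      finally show ?thesis using D_closed(3)[OF that, of "1 / 3"] by simp
    qed
    then show ?thesis using False N that by (intro tr_long_word_coprime_6) auto
  qed
  have "N \<ge> 3" using N by (auto split: if_splits)
  then show ?thesis
    unfolding g(1) using invariant3_long_word_D[OF tr _ g(2) long] by blast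
qed

section \<open>Substitution\<close>

definition monomial_value :: "('v \<Rightarrow> 'r::comm_ring_1) \<Rightarrow> ('v \<Rightarrow>\<^sub>0 nat) \<Rightarrow> 'r" where
  "monomial_value \<phi> m = (\<Prod>v\<in>Poly_Mapping.keys m. \<phi> v ^ Poly_Mapping.lookup m v)"

lemma monomial_value_superset:
  assumes "finite S" "Poly_Mapping.keys m \<subseteq> S"
  shows "monomial_value \<phi> m = (\<Prod>v\<in>S. \<phi> v ^ Poly_Mapping.lookup m v)"
  unfolding monomial_value_def using assms
  by (intro prod.mono_neutral_left) (auto simp: in_keys_iff)

lemma monomial_value_add: "monomial_value \<phi> (m + m') = monomial_value \<phi> m * monomial_value \<phi> m'"
proof -
  let ?S = "Poly_Mapping.keys m \<union> Poly_Mapping.keys m'"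
  have "monomial_value \<phi> (m + m') = (\<Prod>v\<in>?S. \<phi> v ^ Poly_Mapping.lookup (m + m') v)"
    using keys_add[of m m'] by (intro monomial_value_superset) auto
  also have "\<dots> = (\<Prod>v\<in>?S. \<phi> v ^ Poly_Mapping.lookup m v) * (\<Prod>v\<in>?S. \<phi> v ^ Poly_Mapping.lookup m' v)"
    by (simp add: lookup_add power_add prod.distrib)
  also have "\<dots> = monomial_value \<phi> m * monomial_value \<phi> m'"
    using monomial_value_superset[of ?S m \<phi>] monomial_value_superset[of ?S m' \<phi>] by simp
  finally show ?thesis .
qed

locale substitution =
  fixes \<iota> :: "'a::comm_ring_1 \<Rightarrow> 'r::comm_ring_1" and \<phi> :: "'v \<Rightarrow> 'r"
  assumes \<iota>_add: "\<iota> (x + y) = \<iota> x + \<iota> y" and \<iota>_mult: "\<iota> (x * y) = \<iota> x * \<iota> y" and \<iota>_one: "\<iota> 1 = 1"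
begin

lemma \<iota>_zero: "\<iota> 0 = 0"
  using \<iota>_add[of 0 0] by simp

definition subst :: "('v, 'a) mvpoly \<Rightarrow> 'r" where
  "subst p = (\<Sum>m\<in>Poly_Mapping.keys p. \<iota> (Poly_Mapping.lookup p m) * monomial_value \<phi> m)"

lemma subst_superset:
  assumes "finite S" "Poly_Mapping.keys p \<subseteq> S"
  shows "subst p = (\<Sum>m\<in>S. \<iota> (Poly_Mapping.lookup p m) * monomial_value \<phi> m)"
  unfolding subst_def using assms
  by (intro sum.mono_neutral_left) (auto simp: in_keys_iff \<iota>_zero)

lemma subst_add: "subst (p + q) = subst p + subst q"
proof -
  let ?S = "Poly_Mapping.keys p \<union> Poly_Mapping.keys q"
  have "subst (p + q) = (\<Sum>m\<in>?S. \<iota> (Poly_Mapping.lookup (p + q) m) * monomial_value \<phi> m)"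
    using keys_add[of p q] by (intro subst_superset) auto
  also have "\<dots> = subst p + subst q"
    using subst_superset[of ?S p] subst_superset[of ?S q]
    by (simp add: lookup_add \<iota>_add distrib_right sum.distrib)
  finally show ?thesis .
qed

lemma subst_zero: "subst 0 = 0" by (simp add: subst_def)

lemma subst_uminus: "subst (- p) = - subst p"
  using subst_add[of p "- p"] subst_zero by (simp add: eq_neg_iff_add_eq_0 add.commute)

lemma subst_diff: "subst (p - q) = subst p - subst q"
  using subst_add[of p "- q"] subst_uminus[of q] by simp

lemma subst_sum: "subst (sum f I) = (\<Sum>i\<in>I. subst (f i))"
  by (induction I rule: infinite_finite_induct) (simp_all add: subst_add subst_zero)

lemma subst_single: "subst (Poly_Mapping.single m c) = \<iota> c * monomial_value \<phi> m"
  by (simp add: subst_def \<iota>_zero)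

lemma sum_of_monomials: "(p :: ('v, 'a) mvpoly) = (\<Sum>m\<in>Poly_Mapping.keys p. Poly_Mapping.single m (Poly_Mapping.lookup p m))"
proof (rule poly_mapping_eqI)
  fix k
  show "Poly_Mapping.lookup p k = Poly_Mapping.lookup (\<Sum>m\<in>Poly_Mapping.keys p. Poly_Mapping.single m (Poly_Mapping.lookup p m)) k"
    by (simp add: lookup_sum lookup_single when_def sum.delta' in_keys_iff)
qed

lemma subst_mult: "subst (p * q) = subst p * subst q"
proof -
  let ?f = "\<lambda>p m. Poly_Mapping.single m (Poly_Mapping.lookup p m)"
  have "subst (p * q) = subst ((\<Sum>m\<in>Poly_Mapping.keys p. ?f p m) * (\<Sum>m'\<in>Poly_Mapping.keys q. ?f q m'))"
    by (simp only: sum_of_monomials[symmetric])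
  also have "\<dots> = (\<Sum>m\<in>Poly_Mapping.keys p. \<Sum>m'\<in>Poly_Mapping.keys q. subst (?f p m) * subst (?f q m'))"
    by (simp add: sum_product subst_sum mult_single subst_single \<iota>_mult monomial_value_add mult_ac)
  also have "\<dots> = subst (\<Sum>m\<in>Poly_Mapping.keys p. ?f p m) * subst (\<Sum>m'\<in>Poly_Mapping.keys q. ?f q m')"
    by (simp add: sum_product subst_sum)
  finally show ?thesis by (simp only: sum_of_monomials[symmetric])
qed

lemma subst_one: "subst 1 = 1"
  using subst_single[of 0 1] by (simp add: \<iota>_one monomial_value_def)

lemma subst_pvar: "subst (pvar v) = \<phi> v"
  by (simp add: pvar_def subst_single \<iota>_one monomial_value_def)

lemma subst_cst: "subst (cst c) = \<iota> c"
  by (simp add: subst_single monomial_value_def)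

lemma subst_pscale: "subst (pscale c p) = \<iota> c * subst p"
  by (simp add: pscale_def subst_mult subst_cst)

lemma map_mat3_subst:
  "map_mat3 subst (A * B) = map_mat3 subst A * map_mat3 subst B"
  "map_mat3 subst (transp3 A) = transp3 (map_mat3 subst A)"
  "map_mat3 subst 1 = 1"
  by (cases A; cases B; simp add: subst_add subst_mult subst_one subst_zero one_mat3_def)+

lemma map_mat3_subst_word: "map_mat3 subst (word X xs) = word (\<lambda>k. map_mat3 subst (X k)) xs"
proof (induction xs)
  case (Cons x xs)
  then show ?case by (cases x) (simp add: map_mat3_subst)
qed (simp add: map_mat3_subst)

lemma invariant3_subst: "subst (invariant3 t M) = invariant3 t (map_mat3 subst M)"
  by (cases M) (simp add: invariant3_def subst_add subst_diff subst_mult)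

end

section \<open>A slice that detects indecomposability\<close>

text \<open>
  Polynomials in two variables \<open>b\<close> and \<open>t\<close>, whose coefficients are polynomials
  in one variable for each matrix.
\<close>

type_synonym ('a, 'd) slice_poly = "('d, 'a) mvpoly poly poly"

definition var_b :: "'c::comm_ring_1 poly poly" where "var_b = [:[:0, 1:]:]"
definition var_t :: "'c::comm_ring_1 poly poly" where "var_t = [:0, 1:]"

definition bicoeff :: "nat \<Rightarrow> nat \<Rightarrow> 'c::comm_ring_1 poly poly \<Rightarrow> 'c" where
  "bicoeff i j q = coeff (coeff q j) i"

lemma bicoeff_simps [simp]:
  "bicoeff i j (p + q) = bicoeff i j p + bicoeff i j q" "bicoeff i j (p - q) = bicoeff i j p - bicoeff i j q" "bicoeff i j (- p) = - bicoeff i j p" "bicoeff i j 0 = 0"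
  "bicoeff i j (var_b * q) = (if i = 0 then 0 else bicoeff (i - 1) j q)"
  "bicoeff i j (var_t * q) = (if j = 0 then 0 else bicoeff i (j - 1) q)"
  "bicoeff i j [:[:c:]:] = (if i = 0 \<and> j = 0 then c else 0)"
  "bicoeff i j ([:[:c:]:] * q) = c * bicoeff i j q"
  by (auto simp: bicoeff_def var_b_def var_t_def coeff_pCons split: nat.splits)

lemma bicoeff_one: "bicoeff i j 1 = (if i = 0 \<and> j = 0 then 1 else 0)"
  by (simp add: bicoeff_def)

lemma bicoeff_mult: "bicoeff i j (p * q) = (\<Sum>l\<le>j. \<Sum>k\<le>i. bicoeff k l p * bicoeff (i - k) (j - l) q)"
  by (simp add: bicoeff_def coeff_mult coeff_sum)

text \<open>
  The matrix \<open>b N + t K\<close> with \<open>N = diag(0, 1, -1)\<close> and \<open>K\<close> the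
  skew-symmetric matrix with axis \<open>(1, 1, 1)\<close>.
\<close>

definition slice_mat :: "'c::comm_ring_1 poly poly mat3" where
  "slice_mat = Mat3 0 (- var_t) var_t  var_t var_b (- var_t)  (- var_t) var_t (- var_b)"

fun slice_word :: "bool list \<Rightarrow> 'c::comm_ring_1 poly poly mat3" where
  "slice_word [] = 1"
| "slice_word (x # xs) = (if x then slice_mat else transp3 slice_mat) * slice_word xs"

lemma slice_word_append: "slice_word (xs @ ys) = slice_word xs * slice_word ys"
  by (induction xs) (simp_all add: mult.assoc)

definition diag_part :: "int mat3" where "diag_part = Mat3 0 0 0 0 1 0 0 0 (- 1)"
definition skew_part :: "bool \<Rightarrow> int mat3" where
  "skew_part x = hat (if x then Vec3 1 1 1 else Vec3 (- 1) (- 1) (- 1))"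

text \<open>
  The integral matrix at \<open>b\<^bsup>n-j\<^esup> t\<^sup>j\<close> in a word of length
  \<open>n\<close> in \<open>b N + t K\<close> and its transpose \<open>b N - t K\<close>.
\<close>

fun word_coeff :: "bool list \<Rightarrow> nat \<Rightarrow> int mat3" where
  "word_coeff [] j = (if j = 0 then 1 else 0)"
| "word_coeff (x # xs) j = diag_part * word_coeff xs j + (if j = 0 then 0 else skew_part x * word_coeff xs (j - 1))"

lemma word_coeff_eq_0: "j > length xs \<Longrightarrow> word_coeff xs j = 0"
  by (induction xs arbitrary: j) auto

lemma map_mat3_of_int:
  "map_mat3 of_int (A * B) = (map_mat3 of_int A * map_mat3 of_int B :: 'c::comm_ring_1 mat3)"
  "map_mat3 of_int (A + B) = (map_mat3 of_int A + map_mat3 of_int B :: 'c mat3)"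
  "map_mat3 of_int 0 = (0 :: 'c mat3)" "map_mat3 of_int 1 = (1 :: 'c mat3)"
  by (cases A; cases B; simp add: zero_mat3_def one_mat3_def)+

lemma bicoeff_slice_letter:
  "map_mat3 (bicoeff i j) ((if x then slice_mat else transp3 slice_mat) * M)
   = (if i = 0 then 0 else map_mat3 of_int diag_part * map_mat3 (bicoeff (i - 1) j) M)
     + (if j = 0 then 0 else map_mat3 of_int (skew_part x) * map_mat3 (bicoeff i (j - 1)) M)"
  by (cases M) (simp add: slice_mat_def diag_part_def skew_part_def zero_mat3_def)

lemma bicoeff_slice_word:
  "map_mat3 (bicoeff i j) (slice_word xs :: 'c::comm_ring_1 poly poly mat3)
   = (if i + j = length xs then map_mat3 of_int (word_coeff xs j) else 0)"
proof (induction xs arbitrary: i j)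
  case Nil
  then show ?case by (auto simp: one_mat3_def zero_mat3_def bicoeff_one)
next
  case (Cons x xs)
  have "j = Suc (length xs) \<Longrightarrow> word_coeff xs j = 0"
    by (simp add: word_coeff_eq_0)
  then show ?case
    unfolding slice_word.simps bicoeff_slice_letter Cons.IH word_coeff.simps
    by (cases i; cases j) (auto simp: map_mat3_of_int)
qed

lemma bicoeff_tr3: "bicoeff i j (tr3 M) = tr3 (map_mat3 (bicoeff i j) M)"
  by (cases M) simp

lemma bicoeff_tr3_slice_word:
  "bicoeff i j (tr3 (slice_word xs)) = (if i + j = length xs then of_int (tr3 (word_coeff xs j)) else (0 :: 'c::comm_ring_1))"
proof -
  have "tr3 (map_mat3 of_int M) = (of_int (tr3 M) :: 'c)" for M by (cases M) simp
  then show ?thesis by (simp add: bicoeff_tr3 bicoeff_slice_word)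
qed

text \<open>
  A finite verification for words of length at most five. Behind it are the facts that \<open>tr N =
  0\<close>, that a diagonal matrix times \<open>K\<close> has trace zero, and that the trace of
  \<open>K N\<^sup>i K N\<^sup>j K N\<^sup>k\<close> is alternating in \<open>i\<close>,
  \<open>j\<close>, \<open>k\<close>, so that it vanishes for \<open>i + j + k < 0 + 1 + 2\<close>.
\<close>

lemma word_coeff_tr_check:
  "length xs = 1 \<Longrightarrow> tr3 (word_coeff xs 0) = 0"
  "length xs \<in> {1, 2, 3, 4} \<Longrightarrow> tr3 (word_coeff xs 1) = 0"
  "length xs \<in> {3, 4, 5} \<Longrightarrow> tr3 (word_coeff xs 3) = 0"
proof -
  have all: "xs \<in> set (List.n_lists (length xs) [True, False])" by (auto simp: set_n_lists)
  have "\<forall>xs\<in>set (List.n_lists 1 [True, False]). tr3 (word_coeff xs 0) = 0" by code_simp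
  then show "length xs = 1 \<Longrightarrow> tr3 (word_coeff xs 0) = 0" using all by auto
  have "\<forall>n\<in>{1, 2, 3, 4}. \<forall>xs\<in>set (List.n_lists n [True, False]). tr3 (word_coeff xs 1) = 0" by code_simp
  then show "length xs \<in> {1, 2, 3, 4} \<Longrightarrow> tr3 (word_coeff xs 1) = 0" using all by blast
  have "\<forall>n\<in>{3, 4, 5}. \<forall>xs\<in>set (List.n_lists n [True, False]). tr3 (word_coeff xs 3) = 0" by code_simp
  then show "length xs \<in> {3, 4, 5} \<Longrightarrow> tr3 (word_coeff xs 3) = 0" using all by blast
qed

lemma det3_slice_word: "xs \<noteq> [] \<Longrightarrow> det3 (slice_word xs :: 'c::comm_ring_1 poly poly mat3) = 0"
proof (cases xs)
  case (Cons x ys)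
  have "det3 (slice_mat :: 'c poly poly mat3) = 0"
    by (simp add: slice_mat_def algebra_simps)
  then show ?thesis by (simp add: Cons det3_mult det3_transp)
qed simp

text \<open>
  The monomial ideal spanned by the monomials that do not divide the monomial with exponent
  \<open>E\<close>.
\<close>

definition exceeding :: "('d \<Rightarrow>\<^sub>0 nat) \<Rightarrow> ('d, 'a::comm_ring_1) mvpoly set" where
  "exceeding E = {r. \<forall>m\<in>Poly_Mapping.keys r. \<exists>k. Poly_Mapping.lookup m k > Poly_Mapping.lookup E k}"

lemma exceeding_zero: "0 \<in> exceeding E"
  by (simp add: exceeding_def)

lemma exceeding_add: "p \<in> exceeding E \<Longrightarrow> q \<in> exceeding E \<Longrightarrow> p + q \<in> exceeding E"
  unfolding exceeding_def using keys_add[of p q] by blast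

lemma exceeding_mult: "p \<in> exceeding E \<Longrightarrow> q * p \<in> exceeding E"
  unfolding exceeding_def using keys_mult[of q p]
  by (fastforce simp: lookup_add intro: trans_less_add2)

lemma exceeding_single:
  "Poly_Mapping.lookup m k > Poly_Mapping.lookup E k \<Longrightarrow> Poly_Mapping.single m c \<in> exceeding E"
  by (auto simp: exceeding_def)

text \<open>
  Conditions on low coefficients that hold for the images of all invariants of positive degree and imply
  that the coefficient of a product at \<open>b\<^sup>3 t\<^sup>3\<close> lies in the ideal
  \<^term>\<open>exceeding E\<close>: every splitting of \<open>(3, 3)\<close> into two bidegrees
  involves one of the coefficients listed here.
\<close>

definition slice_good :: "('d \<Rightarrow>\<^sub>0 nat) \<Rightarrow> ('a::comm_ring_1, 'd) slice_poly \<Rightarrow> bool" where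
  "slice_good E q \<longleftrightarrow> (\<forall>i\<le>3. bicoeff i 1 q = 0) \<and> bicoeff 1 0 q = 0 \<and> (\<forall>i<3. bicoeff i 3 q = 0) \<and> bicoeff 0 0 q \<in> exceeding E"

lemma slice_good_zero: "slice_good E 0"
  by (simp add: slice_good_def exceeding_zero)

lemma slice_good_add: "slice_good E p \<Longrightarrow> slice_good E q \<Longrightarrow> slice_good E (p + q)"
  by (simp add: slice_good_def exceeding_add)

lemma slice_good_const: "slice_good E q \<Longrightarrow> slice_good E ([:[:r:]:] * q)"
  by (simp only: slice_good_def bicoeff_simps mult_zero_right exceeding_mult) simp

lemma slice_good_mult:
  assumes "slice_good E p" "slice_good E q" shows "slice_good E (p * q)"
  unfolding slice_good_def
proof (intro conjI allI impI)
  have p: "\<And>i. i \<le> 3 \<Longrightarrow> bicoeff i (Suc 0) p = 0" "bicoeff (Suc 0) 0 p = 0" "\<And>i. i < 3 \<Longrightarrow> bicoeff i 3 p = 0" "bicoeff 0 0 p \<in> exceeding E"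
    and q: "\<And>i. i \<le> 3 \<Longrightarrow> bicoeff i (Suc 0) q = 0" "bicoeff (Suc 0) 0 q = 0" "\<And>i. i < 3 \<Longrightarrow> bicoeff i 3 q = 0" "bicoeff 0 0 q \<in> exceeding E"
    using assms by (auto simp: slice_good_def)
  show "bicoeff i 1 (p * q) = 0" if "i \<le> 3" for i
    using that p q by (auto simp: bicoeff_mult intro!: sum.neutral)
  show "bicoeff 1 0 (p * q) = 0"
    using p q by (simp add: bicoeff_mult)
  show "bicoeff i 3 (p * q) = 0" if "i < 3" for i
  proof -
    have "bicoeff k l p * bicoeff (i - k) (3 - l) q = 0" if "l \<le> 3" "k \<le> i" for k l
    proof -
      have "l = 0 \<or> l = 1 \<or> l = 2 \<or> l = 3" using that by auto
      then show ?thesis using that \<open>i < 3\<close> p(1)[of k] p(3)[of k] q(1)[of "i - k"] q(3)[of "i - k"] by auto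
    qed
    then show ?thesis by (simp add: bicoeff_mult)
  qed
  show "bicoeff 0 0 (p * q) \<in> exceeding E"
    using q by (simp add: bicoeff_mult exceeding_mult)
qed

text \<open>
  Of all splittings of \<open>(3, 3)\<close> only \<open>(0, 0) + (3, 3)\<close> survives, in both
  orders.
\<close>

lemma bicoeff_33_mult:
  assumes "slice_good E p" "slice_good E q" shows "bicoeff 3 3 (p * q) \<in> exceeding E"
proof -
  have p: "\<And>i. i \<le> 3 \<Longrightarrow> bicoeff i (Suc 0) p = 0" "bicoeff (Suc 0) 0 p = 0" "\<And>i. i < 3 \<Longrightarrow> bicoeff i 3 p = 0" "bicoeff 0 0 p \<in> exceeding E"
    and q: "\<And>i. i \<le> 3 \<Longrightarrow> bicoeff i (Suc 0) q = 0" "bicoeff (Suc 0) 0 q = 0" "\<And>i. i < 3 \<Longrightarrow> bicoeff i 3 q = 0" "bicoeff 0 0 q \<in> exceeding E"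
    using assms by (auto simp: slice_good_def)
  have "bicoeff 3 3 (p * q) = bicoeff 3 3 q * bicoeff 0 0 p + bicoeff 3 3 p * bicoeff 0 0 q"
    using p q by (simp add: bicoeff_mult numeral_3_eq_3)
  then show ?thesis
    using p q by (simp add: exceeding_add exceeding_mult)
qed

lemma slice_good_tr3:
  assumes "xs \<noteq> []" shows "slice_good E (tr3 (slice_word xs))"
proof -
  have "length xs > 0" using assms by simp
  then show ?thesis
    using word_coeff_tr_check[of xs]
    by (auto simp: slice_good_def bicoeff_tr3_slice_word exceeding_zero le_Suc_eq numeral_eq_Suc less_Suc_eq)
qed

lemma const_one: "[:[:1:]:] = (1 :: 'c::comm_ring_1 poly poly)"
  by (simp add: pCons_one)

lemma const_uminus_one: "[:[:- 1:]:] = (- 1 :: 'c::comm_ring_1 poly poly)"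
  by (simp only: one_pCons minus_pCons minus_zero)

lemma slice_good_invariant3:
  assumes half: "2 * hf = (1 :: ('d, 'a::comm_ring_1) mvpoly)" and "xs \<noteq> []" and t: "t \<in> {1..3}"
  shows "slice_good E (invariant3 t (slice_word xs :: ('a, 'd) slice_poly mat3))"
proof -
  let ?M = "slice_word xs :: ('a, 'd) slice_poly mat3"
  have "t = 1 \<or> t = 2 \<or> t = 3" using t by auto
  moreover have "slice_good E (minors3 ?M)"
  proof -
    have "[:[:hf:]:] * (tr3 ?M * tr3 ?M + [:[:- 1:]:] * tr3 (slice_word (xs @ xs))) = [:[:hf:]:] * (2 * minors3 ?M)"
      unfolding twice_minors3 slice_word_append const_uminus_one by simp
    also have "\<dots> = ([:[:hf:]:] + [:[:hf:]:]) * minors3 ?M"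
      by (simp only: mult_2 distrib_left distrib_right)
    also have "[:[:hf:]:] + [:[:hf:]:] = [:[:2 * hf:]:]"
      by (simp only: add_pCons add_0 mult_2)
    also have "[:[:2 * hf:]:] * minors3 ?M = minors3 ?M"
      by (simp only: half const_one mult_1)
    finally have "minors3 ?M = [:[:hf:]:] * (tr3 ?M * tr3 ?M + [:[:- 1:]:] * tr3 (slice_word (xs @ xs)))"
      by (rule sym)
    also have "slice_good E \<dots>"
      using assms(2) by (intro slice_good_const slice_good_add slice_good_mult slice_good_tr3) simp_all
    finally show ?thesis .
  qed
  ultimately show ?thesis
    using assms by (elim disjE) (simp_all add: invariant3_simps slice_good_tr3 det3_slice_word slice_good_zero)
qed

text \<open>
  The matrix with index \<open>k0\<close> is replaced by \<^const>\<open>slice_mat\<close>, and each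
  other one by a scalar matrix.
\<close>

fun slice_entry :: "'d \<Rightarrow> 3 \<times> 3 \<times> 'd \<Rightarrow> ('a::comm_ring_1, 'd) slice_poly" where
  "slice_entry k0 (i, j, k) =
    (if k = k0 then
       (if i = 1 then (if j = 1 then 0 else if j = 2 then - var_t else var_t)
        else if i = 2 then (if j = 1 then var_t else if j = 2 then var_b else - var_t)
        else (if j = 1 then - var_t else if j = 2 then var_t else - var_b))
     else if i = j then [:[:pvar k:]:] else 0)"

lemma substitution_slice: "substitution (\<lambda>x. [:[:cst x:]:] :: ('a::comm_ring_1, 'd) slice_poly)"
  by unfold_locales (simp_all add: single_add mult_single const_one)

definition slice_subst :: "'d \<Rightarrow> ('a::comm_ring_1, 'd) matrix_poly \<Rightarrow> ('a, 'd) slice_poly" where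
  "slice_subst k0 = substitution.subst (\<lambda>x. [:[:cst x:]:]) (slice_entry k0)"

lemma slice_subst_simps:
  "slice_subst k0 0 = 0" "slice_subst k0 (p + q) = slice_subst k0 p + slice_subst k0 q"
  "slice_subst k0 (p * q) = slice_subst k0 p * slice_subst k0 q"
  "slice_subst k0 (pscale c p) = [:[:cst c:]:] * slice_subst k0 p"
  by (simp_all only: slice_subst_def substitution.subst_zero[OF substitution_slice]
      substitution.subst_add[OF substitution_slice] substitution.subst_mult[OF substitution_slice]
      substitution.subst_pscale[OF substitution_slice])

text \<open>
  The exponent of the monomial that is contributed by the scalar matrices in a word.
\<close>

definition off_exponent :: "'d \<Rightarrow> (bool \<times> 'd) list \<Rightarrow> 'd \<Rightarrow>\<^sub>0 nat" where
  "off_exponent k0 xs = sum_list (map (\<lambda>x. if snd x = k0 then 0 else Poly_Mapping.single (snd x) 1) xs)"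

lemma off_exponent_simps:
  "off_exponent k0 [] = 0"
  "off_exponent k0 (x # xs) = (if snd x = k0 then 0 else Poly_Mapping.single (snd x) 1) + off_exponent k0 xs"
  by (simp_all add: off_exponent_def)

lemma map_mat3_slice_generic_mat3:
  "map_mat3 (slice_subst k0) (generic_mat3 k) = (if k = k0 then slice_mat else smul [:[:pvar k:]:] 1)"
  by (simp add: generic_mat3_def to_mat3_def Let_def generic_matrix_def slice_subst_def substitution.subst_pvar[OF substitution_slice]
      slice_mat_def one_mat3_def)

lemma slice_subst_word:
  "map_mat3 (slice_subst k0) (word (generic_mat3 :: 'd \<Rightarrow> ('a::comm_ring_1, 'd) matrix_poly mat3) xs)
   = smul [:[:Poly_Mapping.single (off_exponent k0 xs) 1:]:] (slice_word (map fst (filter (\<lambda>x. snd x = k0) xs)))"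
proof -
  have "map_mat3 (slice_subst k0) (word (generic_mat3 :: 'd \<Rightarrow> ('a, 'd) matrix_poly mat3) xs) = word (\<lambda>k. if k = k0 then slice_mat else smul [:[:pvar k:]:] 1) xs"
    unfolding slice_subst_def substitution.map_mat3_subst_word[OF substitution_slice]
    unfolding slice_subst_def[symmetric] map_mat3_slice_generic_mat3 ..
  also have "\<dots> = smul [:[:Poly_Mapping.single (off_exponent k0 xs) 1:]:] (slice_word (map fst (filter (\<lambda>x. snd x = k0) xs)))"
  proof (induction xs)
    case Nil
    show ?case by (simp add: off_exponent_simps smul_simps const_one)
  next
    case (Cons x xs)
    obtain b k where x: "x = (b, k)" by force
    show ?case
      by (simp add: x Cons off_exponent_simps smul_simps pvar_def mult_single add.commute)
  qed
  finally show ?thesis .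
qed

lemma invariant3_smul:
  assumes "t \<in> {1..3}" shows "invariant3 t (smul r M) = r ^ t * invariant3 t M"
proof -
  have "t = 1 \<or> t = 2 \<or> t = 3" using assms by auto
  then show ?thesis by (elim disjE) (simp_all add: invariant3_simps minors3_smul det3_smul)
qed

lemma const_power: "[:[:r:]:] ^ n = ([:[:r ^ n:]:] :: 'c::comm_ring_1 poly poly)"
  by (induction n) (simp_all add: const_one)

lemma slice_good_const_iff: "slice_good E [:[:r:]:] \<longleftrightarrow> r \<in> exceeding E"
  by (simp add: slice_good_def)

lemma single_power_3: "Poly_Mapping.single e 1 ^ 3 = (Poly_Mapping.single (e + e + e) 1 :: ('v, 'a::comm_ring_1) mvpoly)"
  by (simp add: power3_eq_cube mult_single)

lemma off_exponent_pos:
  assumes "xs \<noteq> []" "filter (\<lambda>x. snd x = k0) xs = []"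
  shows "\<exists>k. Poly_Mapping.lookup (off_exponent k0 xs) k > 0"
  using assms by (cases xs) (auto simp: off_exponent_simps lookup_add split: if_splits intro!: exI[of _ "snd (hd xs)"])

text \<open>
  If the word contains the index \<open>k0\<close>, the scalar matrices only contribute a factor.
  Otherwise the word is a scalar matrix \<open>a\<close>, with invariants \<open>3 a\<close>, \<open>3
  a\<^sup>2\<close> and \<open>a\<^sup>3\<close>; in characteristic three only the cube is left, which
  exceeds every exponent with entries at most two, while any positive power of \<open>a\<close> exceeds
  the exponent zero.
\<close>

lemma slice_good_generator:
  fixes E :: "'d \<Rightarrow>\<^sub>0 nat"
  assumes half: "2 * hf = (1 :: ('d, 'a::comm_ring_1) mvpoly)"
    and E: "E = 0 \<or> (3 :: 'a) = 0 \<and> (\<forall>k. Poly_Mapping.lookup E k \<le> 2)"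
    and xs: "xs \<noteq> []" and t: "t \<in> {1..3}"
  shows "slice_good E (slice_subst k0 (invariant3 t (word generic_mat3 xs :: ('a, 'd) matrix_poly mat3)))"
proof -
  let ?e = "off_exponent k0 xs" and ?bs = "map fst (filter (\<lambda>x. snd x = k0) xs)"
  let ?a = "Poly_Mapping.single ?e 1 :: ('d, 'a) mvpoly"
  have eq: "slice_subst k0 (invariant3 t (word generic_mat3 xs :: ('a, 'd) matrix_poly mat3))
      = [:[:?a ^ t:]:] * invariant3 t (slice_word ?bs)"
    unfolding slice_subst_def substitution.invariant3_subst[OF substitution_slice]
    unfolding slice_subst_def[symmetric] slice_subst_word invariant3_smul[OF t] const_power ..
  show ?thesis
  proof (cases "?bs = []")
    case False
    then show ?thesis unfolding eq by (intro slice_good_const slice_good_invariant3[OF half _ t])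
  next
    case True
    then obtain k where k: "Poly_Mapping.lookup ?e k > 0" using off_exponent_pos[OF xs, of k0] by auto
    have "t = 1 \<or> t = 2 \<or> t = 3" using t by auto
    then consider "t \<in> {1, 2}" | "t = 3" by blast
    then show ?thesis
    proof cases
      case 1
      have "invariant3 t (1 :: ('a, 'd) slice_poly mat3) = 3"
        using 1 by (elim insertE emptyE) (simp_all add: invariant3_simps, simp_all add: one_mat3_def)
      then have "slice_subst k0 (invariant3 t (word generic_mat3 xs :: ('a, 'd) matrix_poly mat3)) = [:[:?a ^ t:]:] * [:[:3:]:]"
        unfolding eq True slice_word.simps by (simp only: numeral_poly)
      also have "\<dots> = [:[:3 * ?a ^ t:]:]" by (simp add: mult.commute)
      finally have "slice_subst k0 (invariant3 t (word generic_mat3 xs :: ('a, 'd) matrix_poly mat3)) = [:[:3 * ?a ^ t:]:]" .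
      moreover have "3 * ?a ^ t \<in> exceeding E"
      proof (cases "E = 0")
        case True
        then have "?a \<in> exceeding E" using k by (intro exceeding_single[of _ k]) simp
        moreover have "3 * ?a ^ t = (3 * ?a ^ (t - 1)) * ?a" using 1 by (auto simp: power2_eq_square)
        ultimately show ?thesis using exceeding_mult by metis
      next
        case False
        then have "(3 :: 'a) = 0" using E by blast
        then have "(3 :: ('d, 'a) mvpoly) = 0" by (simp only: single_numeral[symmetric] single_zero)
        then show ?thesis by (simp add: exceeding_zero)
      qed
      ultimately show ?thesis by (simp add: slice_good_const_iff)
    next
      case 2
      have "Poly_Mapping.lookup (?e + ?e + ?e) k > Poly_Mapping.lookup E k"
        using k E by (auto simp: lookup_add dest: spec[of _ k])
      then have "?a ^ 3 \<in> exceeding E"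
        unfolding single_power_3 by (rule exceeding_single)
      then show ?thesis
        unfolding eq True slice_word.simps using 2 by (simp add: invariant3_simps det3_one slice_good_const_iff)
    qed
  qed
qed

lemma exponent_list_le_1:
  assumes "distinct ks" "k0 \<notin> set ks"
  shows "Poly_Mapping.lookup (off_exponent k0 (map (Pair True) ks)) k \<le> (if k \<in> set ks then 1 else 0)"
  using assms by (induction ks) (auto simp: off_exponent_simps lookup_add lookup_single when_def)

lemma off_exponent_append: "off_exponent k0 (xs @ ys) = off_exponent k0 xs + off_exponent k0 ys"
  by (simp add: off_exponent_def)

text \<open>
  The coefficient at \<open>b\<^sup>3 t\<^sup>3\<close> separates this trace from all decomposable
  elements. For the chosen word of length six in \<open>b N + t K\<close> and its transpose it is
  \<open>-16\<close>, which is nonzero as soon as \<open>2\<close> is.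
\<close>

lemma indecomposable_trace:
  fixes E :: "'d::finite \<Rightarrow>\<^sub>0 nat" and k0 :: 'd
  assumes two: "CHAR('a::field) \<noteq> 2"
    and E: "E = 0 \<or> (3 :: 'a) = 0 \<and> (\<forall>k. Poly_Mapping.lookup E k \<le> 2)"
    and ys: "off_exponent k0 ys = E" "\<forall>y\<in>set ys. snd y \<noteq> k0"
  defines "f \<equiv> tr3 (word generic_mat3 (map (\<lambda>b. (b, k0)) [True, True, False, True, False, False] @ ys)) :: ('a, 'd) matrix_poly"
  shows "f \<in> O3_invariants" "homogeneous f" "f \<notin> decomposables O3_invariants" "total_degree f = length ys + 6"
proof -
  interpret graded_generators invariant_generators "O3_invariants :: ('a, 'd) matrix_poly set" by (rule invariant_generators_graded)
  interpret sub: substitution "\<lambda>x. [:[:cst x:]:] :: ('a, 'd) slice_poly" "slice_entry k0" by (rule substitution_slice)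
  let ?s = "slice_subst k0 :: ('a, 'd) matrix_poly \<Rightarrow> ('a, 'd) slice_poly"
  let ?ws = "map (\<lambda>b. (b, k0)) [True, True, False, True, False, False] @ ys"
  have f_eq: "f = invariant3 1 (word generic_mat3 ?ws)" by (simp only: f_def invariant3_simps)
  have "f \<in> invariant_generators"
    unfolding f_eq invariant_generators_def by (intro CollectI exI[of _ 1] exI[of _ ?ws]) simp
  then show "f \<in> O3_invariants" using G_A by blast
  have hom: "hom_degree (1 * length ?ws) f"
    unfolding f_eq by (rule hom_degree_invariant3[OF hom_degree_mat3_word]) simp
  then show "homogeneous f" by (rule hom_degree_homogeneous)
  have half: "2 * cst (1 / 2) = (1 :: ('d, 'a) mvpoly)"
    by (rule numeral_mult_cst_inverse[OF two_invertible[OF two]])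
  have good: "positive_part O3_invariants \<subseteq> {p. slice_good E (?s p)}"
  proof (rule positive_part_minimal)
    show "nonunital_subalgebra {p. slice_good E (?s p)}"
      unfolding nonunital_subalgebra_def mvp.subspace_def
      by (intro conjI ballI allI; simp only: mem_Collect_eq slice_subst_simps slice_good_zero slice_good_add
          slice_good_mult slice_good_const)
    show "pos_gens \<subseteq> {p. slice_good E (?s p)}"
    proof
      fix g assume "g \<in> pos_gens"
      then have "g \<in> invariant_generators" by (simp add: pos_gens_def)
      then obtain t xs where "g = invariant3 t (word generic_mat3 xs)" "t \<in> {1..3}" "xs \<noteq> []"
        unfolding invariant_generators_def by blast
      then show "g \<in> {p. slice_good E (?s p)}"
        using slice_good_generator[OF half E, of xs t k0] by simp
    qed
  qed
  have "decomposables O3_invariants \<subseteq> {p. bicoeff 3 3 (?s p) \<in> exceeding E}"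
  proof (rule D_minimal)
    show "mvp.subspace {p. bicoeff 3 3 (?s p) \<in> exceeding E}"
      unfolding mvp.subspace_def
      by (intro conjI ballI allI; simp only: mem_Collect_eq slice_subst_simps bicoeff_simps exceeding_zero exceeding_add
          exceeding_mult)
    fix p q :: "('a, 'd) matrix_poly" assume "p \<in> positive_part O3_invariants" "q \<in> positive_part O3_invariants"
    then show "p * q \<in> {p. bicoeff 3 3 (?s p) \<in> exceeding E}"
      using good bicoeff_33_mult[of E "?s p" "?s q"] by (auto simp: slice_subst_simps)
  qed
  moreover have "bicoeff 3 3 (?s f) \<notin> exceeding E"
  proof -
    have "filter (\<lambda>x. snd x = k0) ys = []" using ys(2) by (simp add: filter_empty_conv)
    moreover have "off_exponent k0 ?ws = E" using ys(1) by (simp add: off_exponent_simps)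
    ultimately have "?s f = [:[:Poly_Mapping.single E 1:]:] * tr3 (slice_word [True, True, False, True, False, False])"
      unfolding f_eq slice_subst_def sub.invariant3_subst
      unfolding slice_subst_def[symmetric] slice_subst_word by (simp add: invariant3_simps)
    moreover have "tr3 (word_coeff [True, True, False, True, False, False] 3) = - 16" by code_simp
    ultimately have "bicoeff 3 3 (?s f) = Poly_Mapping.single E 1 * of_int (- 16)"
      by (simp only: bicoeff_simps bicoeff_tr3_slice_word) simp
    also have "\<dots> = Poly_Mapping.single E (- 16)"
      by (simp only: single_of_int[symmetric] mult_single) simp
    finally have "bicoeff 3 3 (?s f) = Poly_Mapping.single E (- 16)" .
    moreover have "(16 :: 'a) = 2 ^ 4" by simp
    then have "(- 16 :: 'a) \<noteq> 0"
      using two_invertible[OF two] by (simp only: neg_equal_0_iff_equal power_not_zero not_False_eq_True)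
    ultimately show ?thesis by (simp add: exceeding_def)
  qed
  ultimately show nf: "f \<notin> decomposables O3_invariants" by blast
  then have "f \<noteq> 0" using D_closed(1) by blast
  then show "total_degree f = length ys + 6"
    using hom_degree_homogeneous(2)[OF hom] by simp
qed

text \<open>
  In characteristic three the exponent two is not exceeded, so each of the scalar matrices can be
  inserted twice.
\<close>

lemma lower_bound:
  assumes two: "CHAR('a::field) \<noteq> 2"
  shows "\<exists>f\<in>O3_invariants :: ('a, 'd::finite) matrix_poly set. homogeneous f \<and> f \<notin> decomposables O3_invariants \<and>
    total_degree f = (if CHAR('a) = 3 then 2 * CARD('d) + 4 else 6)"
proof -
  obtain k0 :: 'd where True by blast
  obtain ks where ks: "set ks = UNIV - {k0}" "distinct ks"
    using finite_distinct_list[of "UNIV - {k0}"] by auto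
  have card: "Suc (length ks) = CARD('d)"
    using distinct_card[OF ks(2)] ks(1) card_Suc_Diff1[of UNIV k0] by simp
  show ?thesis
  proof (cases "CHAR('a) = 3")
    case True
    let ?ys = "map (Pair True) ks @ map (Pair True) ks"
    have "Poly_Mapping.lookup (off_exponent k0 ?ys) k \<le> 2" for k
      using exponent_list_le_1[OF ks(2), of k0 k] ks(1)
      by (auto simp: off_exponent_append lookup_add split: if_splits)
    moreover have "(3 :: 'a) = 0" using True of_nat_CHAR[where 'a = 'a] by simp
    moreover have "\<forall>y\<in>set ?ys. snd y \<noteq> k0" using ks by auto
    ultimately show ?thesis
      using indecomposable_trace[OF two _ refl, of k0 ?ys] True card by (intro bexI) auto
  next
    case False
    then show ?thesis
      using indecomposable_trace[OF two _ refl, of k0 "[]"] by (intro bexI) (auto simp: off_exponent_simps)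
  qed
qed

section \<open>The maximal degree of an indecomposable invariant\<close>

theorem theorem1p1:
  fixes R_O3 :: "('a::field, 'd::finite) matrix_poly set"
  defines "R_O3 \<equiv> O3_invariants"
  assumes "infinite (UNIV :: 'a set)" and "CHAR('a) \<noteq> 2"
  shows "\<exists>D. is_D_max R_O3 D \<and>
    (\<exists>G. minimal_homogeneous_generators R_O3 G) \<and>
    (\<forall>G. minimal_homogeneous_generators R_O3 G \<longrightarrow>
       (\<exists>g\<in>G. total_degree g = D) \<and> (\<forall>g\<in>G. total_degree g \<le> D)) \<and>
    (CHAR('a) = 3 \<longrightarrow> 2 * CARD('d) + 4 \<le> D \<and> D \<le> 2 * CARD('d) + 7) \<and>
    (CHAR('a) \<noteq> 3 \<longrightarrow> D = 6)"
proof -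
  define L where "L = (if CHAR('a) = 3 then 2 * CARD('d) + 4 else 6)"
  define N where "N = (if CHAR('a) = 3 then 2 * CARD('d) + 7 else 6)"
  obtain f where f: "f \<in> R_O3" "homogeneous f" "f \<notin> decomposables R_O3" "total_degree f = L"
    unfolding R_O3_def L_def using lower_bound[OF assms(3)] by blast
  have "g \<in> decomposables R_O3" if "g \<in> invariant_generators" "total_degree g > N" for g
    using that upper_bound[OF assms(3)] unfolding R_O3_def N_def by (auto split: if_splits)
  moreover have "L > 0" by (simp add: L_def)
  ultimately have "\<exists>D. is_D_max R_O3 D \<and> (\<exists>B. minimal_homogeneous_generators R_O3 B) \<and>
    (\<forall>B. minimal_homogeneous_generators R_O3 B \<longrightarrow>
       (\<exists>g\<in>B. total_degree g = D) \<and> (\<forall>g\<in>B. total_degree g \<le> D)) \<and> L \<le> D \<and> D \<le> N"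
    using f by (intro graded_generators.maximal_degree_exists[OF invariant_generators_graded[where 'a = 'a and 'd = 'd, folded R_O3_def]])
      auto
  then obtain D where "is_D_max R_O3 D \<and> (\<exists>B. minimal_homogeneous_generators R_O3 B) \<and>
    (\<forall>B. minimal_homogeneous_generators R_O3 B \<longrightarrow>
       (\<exists>g\<in>B. total_degree g = D) \<and> (\<forall>g\<in>B. total_degree g \<le> D)) \<and> L \<le> D \<and> D \<le> N"
    by blast
  then show ?thesis
    by (intro exI[of _ D]) (auto simp: L_def N_def split: if_splits)
qed

end
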